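(* Let $\nu$ be a probability measure on $[0,\infty[$ with $\nu\neq\delta_0$ and finite third moment $m_3(\nu):=\int_0^\infty x^3\,d\nu(x)<\infty$, and put $\sigma^2:=\int_0^\infty x^2\,d\nu(x)$. Let $(p_n)_{n\ge1}\subset\mathbb{N}$ be a sequence of dimensions with $p_n\to\infty$ and $\lim_{n\to\infty} n/p_n^3=\infty$. Then the random variables $$\frac{\sqrt{p_n}}{n\sigma^2\sqrt2}\left(\|S_n^{p_n}\|_2^2-n\sigma^2\right)$$ converge in distribution for $n\to\infty$ to the standard normal distribution $N(0,1)$.
   Context: For each $p\in\mathbb{N}$, $\nu_p$ denotes the unique radial (i.e. invariant under all orthogonal transformations) probability measure on $\mathbb{R}^p$ whose image under the map $x\mapsto\|x\|_2$ (Euclidean norm) is $\nu$. For each $p\in\mathbb{N}$, $(X_k^p)_{k\ge1}$ are i.i.d. $\mathbb{R}^p$-valued random variables with law $\nu_p$, and $S_n^p:=\sum_{k=1}^n X_k^p$. *)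

theory Defs
  imports "HOL-Probability.Probability"
begin

text \<open>
  The dimension varies with \<open>n\<close>, so \<open>\<real>\<^sup>p\<close> is modelled as the space of functions
  \<open>nat \<Rightarrow> real\<close> supported (in the sense of \<^const>\<open>extensional\<close>) on \<open>{..<p}\<close>, with its Borel
  (product) sigma-algebra. The Euclidean norm of \<open>x\<close> is \<open>L2_set x {..<p}\<close>.
\<close>

abbreviation borel_Rn :: "nat \<Rightarrow> (nat \<Rightarrow> real) measure" where
  "borel_Rn p \<equiv> Pi\<^sub>M {..<p} (\<lambda>_. borel)"

abbreviation norm_Rn :: "nat \<Rightarrow> (nat \<Rightarrow> real) \<Rightarrow> real" where
  "norm_Rn p x \<equiv> L2_set x {..<p}"

definition mat_apply :: "nat \<Rightarrow> (nat \<Rightarrow> nat \<Rightarrow> real) \<Rightarrow> (nat \<Rightarrow> real) \<Rightarrow> nat \<Rightarrow> real" where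
  "mat_apply p A x = (\<lambda>i\<in>{..<p}. \<Sum>j<p. A i j * x j)"

text \<open>\<open>A\<^sup>T A = I\<close>; only the entries with both indices below \<open>p\<close> matter.\<close>

definition orthogonal_mat_Rn :: "nat \<Rightarrow> (nat \<Rightarrow> nat \<Rightarrow> real) \<Rightarrow> bool" where
  "orthogonal_mat_Rn p A \<longleftrightarrow>
     (\<forall>i<p. \<forall>j<p. (\<Sum>k<p. A k i * A k j) = (if i = j then 1 else 0))"

definition radial_measure :: "nat \<Rightarrow> (nat \<Rightarrow> real) measure \<Rightarrow> bool" where
  "radial_measure p \<mu> \<longleftrightarrow>
     sets \<mu> = sets (borel_Rn p) \<and>
     (\<forall>A. orthogonal_mat_Rn p A \<longrightarrow> distr \<mu> (borel_Rn p) (mat_apply p A) = \<mu>)"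

text \<open>
  For \<open>p \<ge> 1\<close> and a probability measure \<open>\<nu>\<close> on \<open>[0,\<infinity>[\<close> this determines \<open>\<mu>\<close> uniquely:
  it is the measure written \<open>\<nu>\<^sub>p\<close>.
\<close>

definition radial_prob_with_norm_law :: "real measure \<Rightarrow> nat \<Rightarrow> (nat \<Rightarrow> real) measure \<Rightarrow> bool" where
  "radial_prob_with_norm_law \<nu> p \<mu> \<longleftrightarrow>
     prob_space \<mu> \<and> radial_measure p \<mu> \<and> distr \<mu> borel (norm_Rn p) = \<nu>"

definition partial_sum_Rn ::
  "nat \<Rightarrow> (nat \<Rightarrow> 'a \<Rightarrow> nat \<Rightarrow> real) \<Rightarrow> nat \<Rightarrow> 'a \<Rightarrow> nat \<Rightarrow> real" where
  "partial_sum_Rn p X n \<omega> = (\<lambda>i\<in>{..<p}. \<Sum>k=1..n. X k \<omega> i)"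

end

theory Submission
  imports Defs
begin

text \<open>
  Write \<open>S\<^sub>k\<close> for the partial sums in dimension \<open>p\<close>, put \<open>c = sqrt p / (n * \<sigma>\<^sup>2 * sqrt 2)\<close>, and follow
  the scaled excess \<open>T\<^sub>k = c * (\<parallel>S\<^sub>k\<parallel>\<^sup>2 - k * \<sigma>\<^sup>2)\<close> for \<open>k \<le> n\<close>. The theorem is about \<open>T\<^sub>n\<close>. One step of the
  walk adds \<open>a + b\<close> to it, where \<open>a = 2 * c * \<langle>S\<^sub>k, X\<rangle>\<close> and \<open>b = c * (\<parallel>X\<parallel>\<^sup>2 - \<sigma>\<^sup>2)\<close> for the new
  increment \<open>X\<close>. Given \<open>S\<^sub>k\<close>, both have mean zero. A radial law has covariance matrix \<open>\<sigma>\<^sup>2 / p\<close> times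
  the identity (invariance under sign changes and transpositions of coordinates is enough to see
  this), so \<open>a\<^sup>2\<close> has conditional mean \<open>4 * c\<^sup>2 * \<sigma>\<^sup>2 * \<parallel>S\<^sub>k\<parallel>\<^sup>2 / p\<close>.

  Expand \<open>exp (i * s * T)\<close> to second order in \<open>a\<close> and to first order in \<open>b\<close>. For the
  characteristic function \<open>\<phi>\<^sub>k\<close> of \<open>T\<^sub>k\<close> at \<open>s\<close> this gives
  \<open>\<phi>\<^sub>k\<^sub>+\<^sub>1 \<approx> \<phi>\<^sub>k - 2 * s\<^sup>2 * c\<^sup>2 * \<sigma>\<^sup>2 / p * E (exp (i * s * T\<^sub>k) * \<parallel>S\<^sub>k\<parallel>\<^sup>2)\<close>.
  Now \<open>\<parallel>S\<^sub>k\<parallel>\<^sup>2 = k * \<sigma>\<^sup>2 + T\<^sub>k / c\<close>, and the second summand is negligible because \<open>E \<bar>T\<^sub>k\<bar>\<close> stays bounded while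
  \<open>n * c\<close> grows like \<open>sqrt p\<close>. Hence \<open>\<phi>\<^sub>k\<^sub>+\<^sub>1 \<approx> (1 - s\<^sup>2 * k / n\<^sup>2) * \<phi>\<^sub>k\<close>, so that \<open>\<phi>\<^sub>n\<close> is close to the
  exponential of \<open>- s\<^sup>2 * (0 + 1 + \<dots> + (n - 1)) / n\<^sup>2\<close>, which tends to \<open>exp (- s\<^sup>2 / 2)\<close>. Levy's continuity
  theorem finishes the proof. The one-step estimate is \<open>walk_char_Suc\<close>, its iteration
  \<open>walk_char_approx\<close>, and the limit of the error \<open>walk_char_error_tendsto_0\<close>.

  The expansion leaves the remainder \<open>\<bar>a\<bar>\<^sup>3 + \<bar>a\<bar> * \<bar>b\<bar> + \<bar>b\<bar> powr (3/2)\<close>; these exponents are such that only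
  third moments of \<open>\<parallel>X\<parallel>\<close> occur. With \<open>\<bar>\<langle>S\<^sub>k, X\<rangle>\<bar> \<le> \<parallel>S\<^sub>k\<parallel> * \<parallel>X\<parallel>\<close> and \<open>E \<parallel>S\<^sub>k\<parallel>\<^sup>3 = O(n powr (3/2))\<close>, the \<open>n\<close>
  steps together contribute a quantity of order at most \<open>sqrt (p\<^sup>3 / n)\<close>, which is where the hypothesis on the
  growth of \<open>p\<close> enters. The bound on \<open>E \<bar>T\<^sub>k\<bar>\<close> comes from the same expansion applied to the smooth
  substitute \<open>sqrt (1 + t\<^sup>2)\<close> for \<open>\<bar>t\<bar>\<close>; the bound on \<open>E \<parallel>S\<^sub>k\<parallel>\<^sup>3\<close> from a similar recursion.
\<close>

section \<open>Taylor expansions with a remainder of order three halves\<close>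

text \<open>
  The geometric mean of the linear and the quadratic bound. It turns the two standard
  estimates of a Taylor remainder into one that needs only a moment of order \<open>3/2\<close>.
\<close>

lemma le_min_linear_quadratic_imp_three_halves:
  fixes y u :: real
  assumes "y \<le> 2 * \<bar>u\<bar>" "y \<le> u\<^sup>2 / 2"
  shows "y \<le> \<bar>u\<bar> * sqrt \<bar>u\<bar>"
proof (cases "\<bar>u\<bar> \<ge> 4")
  case True
  then have "2 \<le> sqrt \<bar>u\<bar>" using real_le_rsqrt[of 2 "\<bar>u\<bar>"] by simp
  then have "\<bar>u\<bar> * 2 \<le> \<bar>u\<bar> * sqrt \<bar>u\<bar>" by (intro mult_left_mono) auto
  then show ?thesis using assms(1) by simp
next
  case False
  then have "sqrt \<bar>u\<bar> \<le> 2" using real_sqrt_le_mono[of "\<bar>u\<bar>" 4] by simp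
  then have "sqrt \<bar>u\<bar> * sqrt \<bar>u\<bar> \<le> 2 * sqrt \<bar>u\<bar>" by (intro mult_right_mono) auto
  then have "\<bar>u\<bar> / 2 \<le> sqrt \<bar>u\<bar>" by simp
  then have "\<bar>u\<bar> * (\<bar>u\<bar> / 2) \<le> \<bar>u\<bar> * sqrt \<bar>u\<bar>" by (intro mult_left_mono) auto
  moreover have "u\<^sup>2 / 2 = \<bar>u\<bar> * (\<bar>u\<bar> / 2)" by (simp add: power2_eq_square flip: abs_mult)
  ultimately show ?thesis using assms(2) by simp
qed

text \<open>
  The displacement \<open>v\<close> is expanded to second order, since it has finite third moments, but \<open>u\<close> only to
  first order, since it has just moments of order \<open>3/2\<close>. The proof factors \<open>exp (i * (v + u))\<close> and
  expands the factor with \<open>u\<close> first.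
\<close>

lemma iexp_expansion_mixed:
  fixes u v :: real
  shows "cmod (iexp (v + u) - (1 + \<i> * of_real (v + u) - of_real (v\<^sup>2 / 2)))
           \<le> \<bar>v\<bar> ^ 3 / 6 + \<bar>v\<bar> * \<bar>u\<bar> + \<bar>u\<bar> * sqrt \<bar>u\<bar>"
proof -
  have u: "cmod (iexp u - (1 + \<i> * of_real u)) \<le> \<bar>u\<bar> * sqrt \<bar>u\<bar>"
    using iexp_approx1[of u 1] iexp_approx2[of u 1]
    by (intro le_min_linear_quadratic_imp_three_halves) (auto simp: power2_eq_square)
  have v: "cmod (iexp v - 1) \<le> \<bar>v\<bar>"
    using iexp_approx1[of v 0] by simp
  have "(\<Sum>k\<le>2. (\<i> * of_real v) ^ k / fact k) = 1 + \<i> * of_real v - of_real (v\<^sup>2 / 2)"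
    by (simp add: numeral_2_eq_2 power_mult_distrib)
  then have vv: "cmod (iexp v - (1 + \<i> * of_real v - of_real (v\<^sup>2 / 2))) \<le> \<bar>v\<bar> ^ 3 / 6"
    using iexp_approx1[of v 2] by (simp add: fact_numeral numeral_3_eq_3)
  have "iexp (v + u) - (1 + \<i> * of_real (v + u) - of_real (v\<^sup>2 / 2))
      = (iexp v - (1 + \<i> * of_real v - of_real (v\<^sup>2 / 2)))
        + (iexp v - 1) * (\<i> * of_real u) + iexp v * (iexp u - (1 + \<i> * of_real u))"
    by (simp add: algebra_simps exp_add)
  also have "cmod \<dots> \<le> cmod (iexp v - (1 + \<i> * of_real v - of_real (v\<^sup>2 / 2)))
        + cmod ((iexp v - 1) * (\<i> * of_real u)) + cmod (iexp v * (iexp u - (1 + \<i> * of_real u)))"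
    by (intro norm_triangle_mono order_refl)
  also have "\<dots> \<le> \<bar>v\<bar> ^ 3 / 6 + \<bar>v\<bar> * \<bar>u\<bar> + \<bar>u\<bar> * sqrt \<bar>u\<bar>"
    using u v vv by (intro add_mono) (auto simp: norm_mult intro!: mult_right_mono)
  finally show ?thesis .
qed

text \<open>
  The concavity of the square root at \<open>r\<^sup>2 = 1 + t\<^sup>2\<close>: with \<open>w = t / r * u + u\<^sup>2 / (2 * r)\<close> the radicand on the
  left is \<open>r\<^sup>2 + 2 * r * w\<close>, which is at most \<open>(r + w)\<^sup>2\<close>.
\<close>

lemma sqrt_one_plus_square_upper:
  fixes t u :: real
  shows "sqrt (1 + (t + u)\<^sup>2) \<le> sqrt (1 + t\<^sup>2) + t / sqrt (1 + t\<^sup>2) * u + u\<^sup>2 / 2"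
proof (rule real_le_lsqrt)
  define r where "r = sqrt (1 + t\<^sup>2)"
  have r: "r \<ge> 1" "r\<^sup>2 = 1 + t\<^sup>2" unfolding r_def by (auto intro: add_nonneg_nonneg)
  define w where "w = t / r * u + u\<^sup>2 / (2 * r)"
  have w: "w \<le> t / r * u + u\<^sup>2 / 2"
    unfolding w_def using r by (intro add_left_mono divide_left_mono) auto
  have "r * w = t * u + u\<^sup>2 / 2"
    using r(1) unfolding w_def by (simp add: field_simps)
  then have rw: "r * (r + w) = 1 + t\<^sup>2 + t * u + u\<^sup>2 / 2"
    using r(2) by (simp add: algebra_simps power2_eq_square)
  also have "\<dots> = (1 + t\<^sup>2) / 2 + (1 + (t + u)\<^sup>2) / 2"
    by (simp add: field_simps power2_eq_square)
  also have "\<dots> > 0" by (intro add_pos_nonneg) (auto intro: add_pos_nonneg)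
  finally have pos: "r + w > 0" using r by (simp add: zero_less_mult_iff)
  have "1 + (t + u)\<^sup>2 = r\<^sup>2 + 2 * r * w"
    using rw r(2) by (simp add: algebra_simps power2_eq_square)
  also have "\<dots> \<le> (r + w)\<^sup>2" by (simp add: power2_sum)
  also have "\<dots> \<le> (r + (t / r * u + u\<^sup>2 / 2))\<^sup>2"
    using w pos by (intro power_mono) auto
  finally show "1 + (t + u)\<^sup>2 \<le> (sqrt (1 + t\<^sup>2) + t / sqrt (1 + t\<^sup>2) * u + u\<^sup>2 / 2)\<^sup>2"
    unfolding r_def by (simp add: add.assoc)
  show "0 \<le> sqrt (1 + t\<^sup>2) + t / sqrt (1 + t\<^sup>2) * u + u\<^sup>2 / 2"
    using w pos unfolding r_def by simp
qed

lemma abs_div_sqrt_one_plus_square_le_1: "\<bar>t / sqrt (1 + t\<^sup>2)\<bar> \<le> (1::real)"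
proof -
  have "\<bar>t\<bar> \<le> sqrt (1 + t\<^sup>2)" by (intro real_le_rsqrt) auto
  moreover have "sqrt (1 + t\<^sup>2) > 0" by (simp add: add_pos_nonneg)
  ultimately show ?thesis by (simp add: abs_divide)
qed

lemma div_sqrt_one_plus_square_Lipschitz:
  fixes s t :: real
  shows "\<bar>s / sqrt (1 + s\<^sup>2) - t / sqrt (1 + t\<^sup>2)\<bar> \<le> \<bar>s - t\<bar>"
proof -
  have D: "((\<lambda>x. x / sqrt (1 + x\<^sup>2)) has_field_derivative 1 / (sqrt (1 + x\<^sup>2)) ^ 3) (at x within UNIV)"
    for x :: real
  proof -
    have p: "1 + x\<^sup>2 > 0" by (simp add: add_pos_nonneg)
    have q: "(sqrt (1 + x\<^sup>2))\<^sup>2 = 1 + x\<^sup>2" using p by simp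
    have r: "sqrt (1 + x\<^sup>2) > 0" using p by simp
    show ?thesis
      apply (rule derivative_eq_intros refl | use p in simp; fail)+
      using r q p by (simp add: field_simps power2_eq_square power3_eq_cube)
  qed
  have "norm (s / sqrt (1 + s\<^sup>2) - t / sqrt (1 + t\<^sup>2)) \<le> 1 * norm (s - t)"
  proof (rule field_differentiable_bound[OF convex_UNIV D])
    fix x :: real
    have "1 \<le> sqrt (1 + x\<^sup>2)" by simp
    then have "1 \<le> sqrt (1 + x\<^sup>2) ^ 3" by (rule one_le_power)
    then show "norm (1 / sqrt (1 + x\<^sup>2) ^ 3) \<le> 1"
      by (smt (verit) divide_le_eq_1_pos divide_nonneg_pos real_norm_def)
  qed auto
  then show ?thesis by simp
qed

text \<open>
  The counterpart of \<open>iexp_expansion_mixed\<close> for a convex function that dominates \<open>\<bar>t\<bar>\<close>: an upper bound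
  on its expectation bounds the first absolute moment.
\<close>

lemma sqrt_one_plus_square_expansion_mixed:
  fixes t u v :: real
  shows "sqrt (1 + (t + (v + u))\<^sup>2) \<le> sqrt (1 + t\<^sup>2) + t / sqrt (1 + t\<^sup>2) * (v + u)
           + (v\<^sup>2 / 2 + \<bar>v\<bar> * \<bar>u\<bar> + \<bar>u\<bar> * sqrt \<bar>u\<bar>)"
proof -
  define g where "g x = x / sqrt (1 + x\<^sup>2)" for x :: real
  have 1: "sqrt (1 + (t + v + u)\<^sup>2) - sqrt (1 + (t + v)\<^sup>2) - g (t + v) * u \<le> \<bar>u\<bar> * sqrt \<bar>u\<bar>"
  proof (rule le_min_linear_quadratic_imp_three_halves)
    show "sqrt (1 + (t + v + u)\<^sup>2) - sqrt (1 + (t + v)\<^sup>2) - g (t + v) * u \<le> u\<^sup>2 / 2"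
      using sqrt_one_plus_square_upper[of "t + v" u] by (simp add: g_def)
    have "sqrt (1 + (t + v + u)\<^sup>2) \<le> sqrt (1 + (t + v)\<^sup>2) + \<bar>u\<bar>"
      using real_sqrt_sum_squares_triangle_ineq[of 1 0 "t + v" u] by simp
    moreover have "- (g (t + v) * u) \<le> \<bar>u\<bar>"
    proof -
      have "\<bar>g (t + v) * u\<bar> \<le> 1 * \<bar>u\<bar>"
        unfolding abs_mult g_def
        by (intro mult_right_mono abs_div_sqrt_one_plus_square_le_1) auto
      then show ?thesis by linarith
    qed
    ultimately show "sqrt (1 + (t + v + u)\<^sup>2) - sqrt (1 + (t + v)\<^sup>2) - g (t + v) * u \<le> 2 * \<bar>u\<bar>"
      by linarith
  qed
  have "(g (t + v) - g t) * u \<le> \<bar>g (t + v) - g t\<bar> * \<bar>u\<bar>"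
    by (metis abs_ge_self abs_mult)
  also have "\<dots> \<le> \<bar>v\<bar> * \<bar>u\<bar>"
    using div_sqrt_one_plus_square_Lipschitz[of "t + v" t]
    by (intro mult_right_mono) (auto simp: g_def)
  finally have 2: "g (t + v) * u \<le> g t * u + \<bar>v\<bar> * \<bar>u\<bar>" by (simp add: algebra_simps)
  have 3: "sqrt (1 + (t + v)\<^sup>2) \<le> sqrt (1 + t\<^sup>2) + g t * v + v\<^sup>2 / 2"
    using sqrt_one_plus_square_upper[of t v] by (simp add: g_def)
  from 1 2 3 show ?thesis unfolding g_def[symmetric] by (simp add: algebra_simps)
qed

text \<open>
  For \<open>a\<close> and \<open>b\<close> the norms of a vector before and after a step, \<open>b\<^sup>2 - a\<^sup>2\<close> is linear in the step up to
  its squared length. The difference of the two cubes then has no first-order term in expectation.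
\<close>

lemma cube_expansion_upper:
  fixes a b h :: real
  assumes "0 \<le> a" "0 \<le> b" "\<bar>b - a\<bar> \<le> h"
  shows "b ^ 3 \<le> a ^ 3 + 3 / 2 * a * (b\<^sup>2 - a\<^sup>2) + h\<^sup>2 * (3 / 2 * a + h)"
proof -
  have "b ^ 3 - a ^ 3 - 3 / 2 * a * (b\<^sup>2 - a\<^sup>2) = (b - a)\<^sup>2 * (b + a / 2)"
    by (simp add: field_simps power2_eq_square power3_eq_cube)
  also have "\<dots> \<le> h\<^sup>2 * (3 / 2 * a + h)"
    using assms power_mono[of "\<bar>b - a\<bar>" h 2] by (intro mult_mono) auto
  finally show ?thesis by simp
qed

lemma exp_minus_approx:
  fixes z :: real
  assumes "z \<ge> 0"
  shows "\<bar>exp (- z) - (1 - z)\<bar> \<le> z\<^sup>2"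
proof -
  have "1 \<le> (1 + z) * (1 - z + z\<^sup>2)"
    using assms by (simp add: algebra_simps power2_eq_square)
  also have "\<dots> \<le> exp z * (1 - z + z\<^sup>2)"
  proof (rule mult_right_mono)
    have "0 \<le> (1 - z)\<^sup>2 + z" using assms by simp
    then show "0 \<le> 1 - z + z\<^sup>2" using assms by (simp add: power2_diff)
  qed simp
  finally have "exp (- z) \<le> 1 - z + z\<^sup>2"
    by (simp add: exp_minus field_simps)
  moreover have "1 - z \<le> exp (- z)" using exp_ge_add_one_self[of "- z"] by simp
  ultimately show ?thesis by simp
qed

text \<open>
  Here \<open>r\<close> is the norm of the position, \<open>h\<close> that of the increment and \<open>d\<close> their inner product. All
  remainder terms are dominated by a function of \<open>r\<close> times the single function \<open>(h + s)\<^sup>3\<close>, since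
  \<open>\<bar>h\<^sup>2 - s\<^sup>2\<bar> \<le> (h + s)\<^sup>2\<close>. Independence then factorises their expectations.
\<close>

lemma increment_error_bounds:
  fixes c s r h d :: real
  assumes "0 \<le> c" "0 \<le> s" "0 \<le> r" "0 \<le> h" "\<bar>d\<bar> \<le> r * h"
  shows "\<bar>2 * c * d\<bar> ^ 3 \<le> 8 * c ^ 3 * r ^ 3 * (h + s) ^ 3"
    and "\<bar>2 * c * d\<bar> * \<bar>c * (h\<^sup>2 - s\<^sup>2)\<bar> \<le> 2 * c\<^sup>2 * r * (h + s) ^ 3"
    and "\<bar>c * (h\<^sup>2 - s\<^sup>2)\<bar> * sqrt \<bar>c * (h\<^sup>2 - s\<^sup>2)\<bar> \<le> c * sqrt c * (h + s) ^ 3"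
proof -
  have d: "\<bar>d\<bar> \<le> r * (h + s)"
    using assms(5) mult_left_mono[of h "h + s" r] assms(2,3) by linarith
  have a: "\<bar>2 * c * d\<bar> \<le> 2 * c * (r * (h + s))"
    using mult_left_mono[OF d, of "2 * c"] assms(1) by (simp add: abs_mult)
  have "\<bar>h - s\<bar> * \<bar>h + s\<bar> \<le> (h + s) * (h + s)"
    using assms by (intro mult_mono) auto
  then have "\<bar>h\<^sup>2 - s\<^sup>2\<bar> \<le> (h + s)\<^sup>2"
    by (simp add: power2_eq_square flip: abs_mult) (simp add: algebra_simps)
  from mult_left_mono[OF this assms(1)] assms(1)
  have b: "\<bar>c * (h\<^sup>2 - s\<^sup>2)\<bar> \<le> c * (h + s)\<^sup>2" by (simp add: abs_mult)
  show "\<bar>2 * c * d\<bar> ^ 3 \<le> 8 * c ^ 3 * r ^ 3 * (h + s) ^ 3"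
    using power_mono[OF a, of 3] by (simp add: power_mult_distrib mult.assoc)
  show "\<bar>2 * c * d\<bar> * \<bar>c * (h\<^sup>2 - s\<^sup>2)\<bar> \<le> 2 * c\<^sup>2 * r * (h + s) ^ 3"
    using mult_mono[OF a b] assms
    by (simp add: power2_eq_square power3_eq_cube mult_ac)
  have "sqrt \<bar>c * (h\<^sup>2 - s\<^sup>2)\<bar> \<le> sqrt (c * (h + s)\<^sup>2)"
    by (rule real_sqrt_le_mono[OF b])
  also have "\<dots> = sqrt c * (h + s)" using assms by (simp add: real_sqrt_mult)
  finally show "\<bar>c * (h\<^sup>2 - s\<^sup>2)\<bar> * sqrt \<bar>c * (h\<^sup>2 - s\<^sup>2)\<bar> \<le> c * sqrt c * (h + s) ^ 3"
    using mult_mono[OF b, of "sqrt \<bar>c * (h\<^sup>2 - s\<^sup>2)\<bar>" "sqrt c * (h + s)"] assms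
    by (simp add: power2_eq_square power3_eq_cube mult_ac)
qed

section \<open>Euclidean geometry of the partial sums\<close>

definition dot_Rn :: "nat \<Rightarrow> (nat \<Rightarrow> real) \<Rightarrow> (nat \<Rightarrow> real) \<Rightarrow> real" where
  "dot_Rn p x y = (\<Sum>i<p. x i * y i)"

lemma norm_Rn_power2: "(norm_Rn p x)\<^sup>2 = (\<Sum>i<p. (x i)\<^sup>2)"
  unfolding L2_set_def by (simp add: sum_nonneg)

lemma abs_component_le_norm_Rn: "i < p \<Longrightarrow> \<bar>x i\<bar> \<le> norm_Rn p x"
  using member_le_L2_set[of "{..<p}" i "\<lambda>i. \<bar>x i\<bar>"] by (simp add: L2_set_def)

lemma abs_dot_Rn_le: "\<bar>dot_Rn p x y\<bar> \<le> norm_Rn p x * norm_Rn p y"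
proof -
  have "\<bar>dot_Rn p x y\<bar> \<le> (\<Sum>i<p. \<bar>x i\<bar> * \<bar>y i\<bar>)"
    unfolding dot_Rn_def by (rule order_trans[OF sum_abs]) (simp add: abs_mult)
  also have "\<dots> \<le> norm_Rn p x * norm_Rn p y" by (rule L2_set_mult_ineq)
  finally show ?thesis .
qed

lemma norm_Rn_measurable [measurable]: "norm_Rn p \<in> borel_measurable (borel_Rn p)"
  unfolding L2_set_def by measurable

lemma partial_sum_Rn_0: "norm_Rn p (partial_sum_Rn p X 0 \<omega>) = 0"
  by (simp add: partial_sum_Rn_def L2_set_def)

lemma partial_sum_Rn_Suc:
  "i < p \<Longrightarrow> partial_sum_Rn p X (Suc k) \<omega> i = partial_sum_Rn p X k \<omega> i + X (Suc k) \<omega> i"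
  by (simp add: partial_sum_Rn_def)

lemma norm_Rn_partial_sum_Suc_power2:
  "(norm_Rn p (partial_sum_Rn p X (Suc k) \<omega>))\<^sup>2 =
     (norm_Rn p (partial_sum_Rn p X k \<omega>))\<^sup>2
     + 2 * dot_Rn p (partial_sum_Rn p X k \<omega>) (X (Suc k) \<omega>) + (norm_Rn p (X (Suc k) \<omega>))\<^sup>2"
  unfolding norm_Rn_power2 dot_Rn_def
  by (simp add: partial_sum_Rn_Suc power2_sum sum.distrib sum_distrib_left mult.assoc)

lemma norm_Rn_partial_sum_Suc_triangle:
  "\<bar>norm_Rn p (partial_sum_Rn p X (Suc k) \<omega>) - norm_Rn p (partial_sum_Rn p X k \<omega>)\<bar>
     \<le> norm_Rn p (X (Suc k) \<omega>)"
proof -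
  define a b h where "a = norm_Rn p (partial_sum_Rn p X k \<omega>)"
    "b = norm_Rn p (partial_sum_Rn p X (Suc k) \<omega>)" "h = norm_Rn p (X (Suc k) \<omega>)"
  define d where "d = dot_Rn p (partial_sum_Rn p X k \<omega>) (X (Suc k) \<omega>)"
  have d: "\<bar>d\<bar> \<le> a * h" unfolding a_b_h_def d_def by (rule abs_dot_Rn_le)
  have b: "b\<^sup>2 = a\<^sup>2 + 2 * d + h\<^sup>2"
    unfolding a_b_h_def d_def by (rule norm_Rn_partial_sum_Suc_power2)
  have nn: "0 \<le> a" "0 \<le> b" "0 \<le> h" unfolding a_b_h_def by auto
  have "b\<^sup>2 \<le> (a + h)\<^sup>2" unfolding b power2_sum using d by linarith
  then have 1: "b \<le> a + h" by (rule power2_le_imp_le) (use nn in simp)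
  have "\<bar>a - h\<bar>\<^sup>2 \<le> b\<^sup>2" unfolding b power2_abs power2_diff using d by linarith
  then have "\<bar>a - h\<bar> \<le> b" by (rule power2_le_imp_le) (use nn in simp)
  then have "a - b \<le> h" by linarith
  with 1 show ?thesis unfolding a_b_h_def[symmetric] by linarith
qed

section \<open>Random walks with isotropic increments\<close>

definition scaling :: "real \<Rightarrow> nat \<Rightarrow> nat \<Rightarrow> real" where
  "scaling \<sigma> p n = sqrt p / (n * \<sigma>\<^sup>2 * sqrt 2)"

text \<open>
  The total error after \<open>n\<close> steps: from replacing \<open>\<parallel>S\<^sub>k\<parallel>\<^sup>2\<close> by \<open>k * \<sigma>\<^sup>2\<close>, from the three remainder terms
  of the Taylor expansion, and from replacing \<open>1 - z\<close> by \<open>exp (- z)\<close>.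
\<close>

definition walk_char_error :: "real \<Rightarrow> real \<Rightarrow> nat \<Rightarrow> nat \<Rightarrow> real \<Rightarrow> real" where
  "walk_char_error \<sigma> m p n s = (let c = scaling \<sigma> p n in
     n * (2 * s\<^sup>2 * c * \<sigma>\<^sup>2 / p * (2 + n * ((2 * c\<^sup>2 * (\<sigma> * sqrt n) + c * sqrt c) * m))
      + (4 / 3 * \<bar>s\<bar> ^ 3 * c ^ 3 * (n * (3 * \<sigma> ^ 3 * sqrt n + m))
          + 2 * s\<^sup>2 * c\<^sup>2 * (\<sigma> * sqrt n) + \<bar>s\<bar> * sqrt \<bar>s\<bar> * (c * sqrt c)) * m)
      + s ^ 4 / n)"

text \<open>
  The increments enter only through their first two moments, which are those of a radial law, and
  through the third moment \<open>m\<close>, which controls all error terms. The shift by \<open>\<sigma>\<close>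
  makes \<open>(\<parallel>X\<parallel> + \<sigma>)\<^sup>3\<close> dominate, up to constant factors, the lower powers of \<open>\<parallel>X\<parallel>\<close> and the remainder terms of \<open>increment_error_bounds\<close>.
\<close>

locale isotropic_walk = prob_space M for M :: "'a measure" +
  fixes p :: nat and \<sigma> m :: real and X :: "nat \<Rightarrow> 'a \<Rightarrow> nat \<Rightarrow> real"
  assumes p_pos: "p \<ge> 1" and sigma_pos: "\<sigma> > 0"
    and indep: "indep_vars (\<lambda>_. borel_Rn p) X {1..}"
    and integrable_cube: "k \<ge> 1 \<Longrightarrow> integrable M (\<lambda>\<omega>. (norm_Rn p (X k \<omega>) + \<sigma>) ^ 3)"
    and expectation_cube: "k \<ge> 1 \<Longrightarrow> expectation (\<lambda>\<omega>. (norm_Rn p (X k \<omega>) + \<sigma>) ^ 3) = m"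
    and mean_zero: "k \<ge> 1 \<Longrightarrow> i < p \<Longrightarrow> expectation (\<lambda>\<omega>. X k \<omega> i) = 0"
    and covariance: "k \<ge> 1 \<Longrightarrow> i < p \<Longrightarrow> j < p \<Longrightarrow>
      expectation (\<lambda>\<omega>. X k \<omega> i * X k \<omega> j) = (if i = j then \<sigma>\<^sup>2 / p else 0)"
begin

abbreviation S :: "nat \<Rightarrow> 'a \<Rightarrow> nat \<Rightarrow> real" where
  "S k \<omega> \<equiv> partial_sum_Rn p X k \<omega>"

lemma increment_measurable: "k \<ge> 1 \<Longrightarrow> X k \<in> M \<rightarrow>\<^sub>M borel_Rn p"
  using indep unfolding indep_vars_def by auto

lemma increment_Suc_measurable [measurable]: "X (Suc k) \<in> M \<rightarrow>\<^sub>M borel_Rn p"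
  by (rule increment_measurable) simp

lemma partial_sum_measurable [measurable]: "S k \<in> M \<rightarrow>\<^sub>M borel_Rn p"
  unfolding partial_sum_Rn_def
proof (intro measurable_restrict borel_measurable_sum)
  fix i j assume "i \<in> {..<p}" "j \<in> {1..k}"
  then show "(\<lambda>\<omega>. X j \<omega> i) \<in> borel_measurable M"
    using measurable_compose[OF increment_measurable measurable_component_singleton, of j i] by simp
qed

lemma indep_partial_sum_increment: "indep_var (borel_Rn p) (S k) (borel_Rn p) (X (Suc k))"
proof -
  let ?P = "\<lambda>A. \<Pi>\<^sub>M j\<in>A. borel_Rn p"
  have "indep_var (?P {1..k}) (\<lambda>\<omega>. restrict (\<lambda>j. X j \<omega>) {1..k})
                  (?P {Suc k}) (\<lambda>\<omega>. restrict (\<lambda>j. X j \<omega>) {Suc k})"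
    by (rule indep_var_restrict[OF indep]) auto
  moreover have "(\<lambda>f. \<lambda>i\<in>{..<p}. \<Sum>j=1..k. f j i) \<in> ?P {1..k} \<rightarrow>\<^sub>M borel_Rn p"
  proof (intro measurable_restrict borel_measurable_sum)
    fix i j assume "i \<in> {..<p}" "j \<in> {1..k}"
    then have "(\<lambda>f. f j) \<in> ?P {1..k} \<rightarrow>\<^sub>M borel_Rn p" "(\<lambda>x. x i) \<in> borel_measurable (borel_Rn p)"
      by (auto intro: measurable_component_singleton)
    then show "(\<lambda>f. f j i) \<in> borel_measurable (?P {1..k})"
      by (rule measurable_compose)
  qed
  moreover have "(\<lambda>f. f (Suc k)) \<in> ?P {Suc k} \<rightarrow>\<^sub>M borel_Rn p"
    by (rule measurable_component_singleton) simp
  ultimately have "indep_var (borel_Rn p) ((\<lambda>f. \<lambda>i\<in>{..<p}. \<Sum>j=1..k. f j i) \<circ> (\<lambda>\<omega>. restrict (\<lambda>j. X j \<omega>) {1..k}))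
       (borel_Rn p) ((\<lambda>f. f (Suc k)) \<circ> (\<lambda>\<omega>. restrict (\<lambda>j. X j \<omega>) {Suc k}))"
    by (rule indep_var_compose)
  moreover have "(\<lambda>f. \<lambda>i\<in>{..<p}. \<Sum>j=1..k. f j i) \<circ> (\<lambda>\<omega>. restrict (\<lambda>j. X j \<omega>) {1..k}) = S k"
    by (auto simp: fun_eq_iff partial_sum_Rn_def)
  moreover have "(\<lambda>f. f (Suc k)) \<circ> (\<lambda>\<omega>. restrict (\<lambda>j. X j \<omega>) {Suc k}) = X (Suc k)"
    by auto
  ultimately show ?thesis by simp
qed

lemma has_expectation_product:
  fixes u w :: "(nat \<Rightarrow> real) \<Rightarrow> 'b::{real_normed_field,banach,second_countable_topology}"
  assumes [measurable]: "u \<in> borel_measurable (borel_Rn p)" "w \<in> borel_measurable (borel_Rn p)"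
    and "integrable M (\<lambda>\<omega>. u (S k \<omega>))" "integrable M (\<lambda>\<omega>. w (X (Suc k) \<omega>))"
  shows "has_bochner_integral M (\<lambda>\<omega>. u (S k \<omega>) * w (X (Suc k) \<omega>))
           ((\<integral>\<omega>. u (S k \<omega>) \<partial>M) * (\<integral>\<omega>. w (X (Suc k) \<omega>) \<partial>M))"
proof -
  have "indep_var borel (u \<circ> S k) borel (w \<circ> X (Suc k))"
    by (rule indep_var_compose[OF indep_partial_sum_increment assms(1,2)])
  then have "indep_var borel (\<lambda>\<omega>. u (S k \<omega>)) borel (\<lambda>\<omega>. w (X (Suc k) \<omega>))"
    by (simp add: comp_def)
  from indep_var_integrable[OF this assms(3,4)] indep_var_lebesgue_integral[OF this assms(3,4)]
  show ?thesis by (simp add: has_bochner_integral_iff)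
qed

lemma integrable_increment:
  fixes f :: "(nat \<Rightarrow> real) \<Rightarrow> 'b::{banach,second_countable_topology}"
  assumes "k \<ge> 1" "f \<in> borel_measurable (borel_Rn p)"
    and "\<And>h. norm (f h) \<le> C * (norm_Rn p h + \<sigma>) ^ 3"
  shows "integrable M (\<lambda>\<omega>. f (X k \<omega>))"
proof (rule Bochner_Integration.integrable_bound)
  show "integrable M (\<lambda>\<omega>. C * (norm_Rn p (X k \<omega>) + \<sigma>) ^ 3)"
    using integrable_cube[OF assms(1)] by simp
  show "(\<lambda>\<omega>. f (X k \<omega>)) \<in> borel_measurable M"
    by (rule measurable_compose[OF increment_measurable[OF assms(1)] assms(2)])
  show "AE \<omega> in M. norm (f (X k \<omega>)) \<le> norm (C * (norm_Rn p (X k \<omega>) + \<sigma>) ^ 3)"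
  proof (rule AE_I2)
    show "norm (f (X k \<omega>)) \<le> norm (C * (norm_Rn p (X k \<omega>) + \<sigma>) ^ 3)" for \<omega>
      using assms(3)[of "X k \<omega>"] by (simp only: real_norm_def)
  qed
qed

lemma power_norm_le_cube:
  assumes "e \<le> 3"
  shows "norm_Rn p h ^ e \<le> (1 / \<sigma> ^ (3 - e)) * (norm_Rn p h + \<sigma>) ^ 3"
proof -
  have "norm_Rn p h ^ e * \<sigma> ^ (3 - e) \<le> (norm_Rn p h + \<sigma>) ^ e * (norm_Rn p h + \<sigma>) ^ (3 - e)"
    using sigma_pos by (intro mult_mono power_mono) auto
  also have "\<dots> = (norm_Rn p h + \<sigma>) ^ 3"
    using assms by (simp flip: power_add)
  finally show ?thesis using sigma_pos by (simp add: field_simps)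
qed

lemma integrable_increment_power:
  assumes "k \<ge> 1" "e \<le> 3"
  shows "integrable M (\<lambda>\<omega>. norm_Rn p (X k \<omega>) ^ e)"
proof (rule integrable_increment[OF assms(1)])
  show "norm (norm_Rn p h ^ e) \<le> (1 / \<sigma> ^ (3 - e)) * (norm_Rn p h + \<sigma>) ^ 3" for h
    using power_norm_le_cube[OF assms(2), of h] by simp
qed measurable

lemma integrable_increment_component:
  assumes "k \<ge> 1" "i < p"
  shows "integrable M (\<lambda>\<omega>. X k \<omega> i)"
proof (rule integrable_increment[OF assms(1)])
  show "(\<lambda>h. h i) \<in> borel_measurable (borel_Rn p)"
    using assms(2) by (intro measurable_component_singleton) simp
  show "norm (h i) \<le> (1 / \<sigma> ^ (3 - 1)) * (norm_Rn p h + \<sigma>) ^ 3" for h :: "nat \<Rightarrow> real"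
    using power_norm_le_cube[of 1 h] abs_component_le_norm_Rn[OF assms(2), of h] by simp
qed

lemma integrable_increment_components:
  assumes "k \<ge> 1" "i < p" "j < p"
  shows "integrable M (\<lambda>\<omega>. X k \<omega> i * X k \<omega> j)"
proof (rule integrable_increment[OF assms(1)])
  fix h :: "nat \<Rightarrow> real"
  have "\<bar>h i\<bar> * \<bar>h j\<bar> \<le> norm_Rn p h * norm_Rn p h"
    using assms by (intro mult_mono abs_component_le_norm_Rn) auto
  then show "norm (h i * h j) \<le> (1 / \<sigma> ^ (3 - 2)) * (norm_Rn p h + \<sigma>) ^ 3"
    using power_norm_le_cube[of 2 h] by (simp add: abs_mult power2_eq_square)
next
  have [measurable]: "i \<in> {..<p}" "j \<in> {..<p}" using assms by auto
  show "(\<lambda>h. h i * h j) \<in> borel_measurable (borel_Rn p)" by measurable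
qed

lemma expectation_increment_square:
  assumes "k \<ge> 1"
  shows "expectation (\<lambda>\<omega>. (norm_Rn p (X k \<omega>))\<^sup>2) = \<sigma>\<^sup>2"
proof -
  have "expectation (\<lambda>\<omega>. (norm_Rn p (X k \<omega>))\<^sup>2) = (\<Sum>i<p. expectation (\<lambda>\<omega>. X k \<omega> i * X k \<omega> i))"
    using integrable_increment_components[OF assms]
    unfolding norm_Rn_power2 by (simp add: power2_eq_square Bochner_Integration.integral_sum)
  also have "\<dots> = \<sigma>\<^sup>2"
    using covariance[OF assms] p_pos by simp
  finally show ?thesis .
qed

lemma expectation_increment_cube_le:
  assumes "k \<ge> 1"
  shows "expectation (\<lambda>\<omega>. norm_Rn p (X k \<omega>) ^ 3) \<le> m"
  unfolding expectation_cube[OF assms, symmetric]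
  using sigma_pos
  by (intro integral_mono integrable_increment_power integrable_cube assms power_mono) auto

lemma m_nonneg: "m \<ge> 0"
proof -
  have "expectation (\<lambda>\<omega>. (norm_Rn p (X 1 \<omega>) + \<sigma>) ^ 3) \<ge> 0"
    using sigma_pos by (intro Bochner_Integration.integral_nonneg zero_le_power add_nonneg_nonneg) auto
  then show ?thesis using expectation_cube[of 1] by simp
qed

lemma integrable_partial_sum_cube: "integrable M (\<lambda>\<omega>. norm_Rn p (S k \<omega>) ^ 3)"
proof (induction k)
  case 0
  show ?case by (simp add: partial_sum_Rn_0)
next
  case (Suc k)
  show ?case
  proof (rule Bochner_Integration.integrable_bound)
    show "integrable M (\<lambda>\<omega>. 8 * (norm_Rn p (S k \<omega>) ^ 3 + norm_Rn p (X (Suc k) \<omega>) ^ 3))"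
      using Suc integrable_increment_power[of "Suc k" 3] by simp
    show "AE \<omega> in M. norm (norm_Rn p (S (Suc k) \<omega>) ^ 3)
        \<le> norm (8 * (norm_Rn p (S k \<omega>) ^ 3 + norm_Rn p (X (Suc k) \<omega>) ^ 3))"
    proof (rule AE_I2)
      fix \<omega>
      define a h where "a = norm_Rn p (S k \<omega>)" "h = norm_Rn p (X (Suc k) \<omega>)"
      have nn: "0 \<le> a" "0 \<le> h" unfolding a_h_def by auto
      have "norm_Rn p (S (Suc k) \<omega>) \<le> 2 * max a h"
        using norm_Rn_partial_sum_Suc_triangle[of p X k \<omega>] unfolding a_h_def by linarith
      then have "norm_Rn p (S (Suc k) \<omega>) ^ 3 \<le> (2 * max a h) ^ 3"
        by (intro power_mono) auto
      also have "\<dots> \<le> 8 * (a ^ 3 + h ^ 3)"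
        using nn by (auto simp: power_mult_distrib max_def)
      finally show "norm (norm_Rn p (S (Suc k) \<omega>) ^ 3)
        \<le> norm (8 * (norm_Rn p (S k \<omega>) ^ 3 + norm_Rn p (X (Suc k) \<omega>) ^ 3))"
        unfolding a_h_def by simp
    qed
  qed measurable
qed

lemma integrable_partial_sum_power:
  assumes "e \<le> 3"
  shows "integrable M (\<lambda>\<omega>. norm_Rn p (S k \<omega>) ^ e)"
proof (rule Bochner_Integration.integrable_bound)
  show "integrable M (\<lambda>\<omega>. 1 + norm_Rn p (S k \<omega>) ^ 3)"
    using integrable_partial_sum_cube by simp
  show "AE \<omega> in M. norm (norm_Rn p (S k \<omega>) ^ e) \<le> norm (1 + norm_Rn p (S k \<omega>) ^ 3)"
  proof (rule AE_I2)
    fix \<omega>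
    have "x ^ e \<le> 1 + x ^ 3" if "x \<ge> 0" for x :: real
    proof (cases "x \<ge> 1")
      case True
      then show ?thesis using power_increasing[OF assms, of x] by simp
    next
      case False
      have "x ^ e \<le> 1" "0 \<le> x ^ 3" using that False by (auto intro: power_le_one)
      then show ?thesis by linarith
    qed
    then show "norm (norm_Rn p (S k \<omega>) ^ e) \<le> norm (1 + norm_Rn p (S k \<omega>) ^ 3)"
      by simp
  qed
qed measurable

text \<open>
  The next three lemmas are the conditional moments of an increment given the position: \<open>u\<close> is an
  arbitrary weight that depends on the position, and it is either real or complex valued below.
\<close>

lemma has_expectation_dot:
  fixes u :: "(nat \<Rightarrow> real) \<Rightarrow> 'b::{real_normed_field,banach,second_countable_topology}"
  assumes [measurable]: "u \<in> borel_measurable (borel_Rn p)"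
    and "integrable M (\<lambda>\<omega>. u (S k \<omega>) * of_real (norm_Rn p (S k \<omega>)))"
  shows "has_bochner_integral M (\<lambda>\<omega>. u (S k \<omega>) * of_real (dot_Rn p (S k \<omega>) (X (Suc k) \<omega>))) 0"
proof -
  have "has_bochner_integral M
      (\<lambda>\<omega>. \<Sum>i<p. (u (S k \<omega>) * of_real (S k \<omega> i)) * of_real (X (Suc k) \<omega> i))
      (\<Sum>i<p. (\<integral>\<omega>. u (S k \<omega>) * of_real (S k \<omega> i) \<partial>M) * (\<integral>\<omega>. of_real (X (Suc k) \<omega> i) \<partial>M))"
  proof (rule has_bochner_integral_sum)
    fix i assume "i \<in> {..<p}"
    then have [measurable]: "i < p" "i \<in> {..<p}" by auto
    have "integrable M (\<lambda>\<omega>. u (S k \<omega>) * of_real (S k \<omega> i))"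
    proof (rule Bochner_Integration.integrable_bound[OF assms(2)])
      show "AE \<omega> in M. norm (u (S k \<omega>) * of_real (S k \<omega> i))
            \<le> norm (u (S k \<omega>) * of_real (norm_Rn p (S k \<omega>)))"
        by (intro AE_I2) (auto simp: norm_mult intro!: mult_left_mono abs_component_le_norm_Rn \<open>i < p\<close>)
    qed measurable
    then show "has_bochner_integral M (\<lambda>\<omega>. u (S k \<omega>) * of_real (S k \<omega> i) * of_real (X (Suc k) \<omega> i))
       ((\<integral>\<omega>. u (S k \<omega>) * of_real (S k \<omega> i) \<partial>M) * (\<integral>\<omega>. of_real (X (Suc k) \<omega> i) \<partial>M))"
      using integrable_increment_component[of "Suc k" i]
      by (intro has_expectation_product[where u = "\<lambda>x. u x * of_real (x i)" and w = "\<lambda>h. of_real (h i)"]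
            integrable_bounded_linear[OF bounded_linear_of_real])
         (auto simp: \<open>i < p\<close>)
  qed
  moreover have "(\<integral>\<omega>. of_real (X (Suc k) \<omega> i) \<partial>M) = (0::'b)" if "i < p" for i
    using integral_bounded_linear[OF bounded_linear_of_real integrable_increment_component[of "Suc k" i]]
      mean_zero[of "Suc k" i] that by simp
  ultimately show ?thesis
    by (simp add: dot_Rn_def sum_distrib_left mult.assoc)
qed

text \<open>
  This is the only place where the covariance of the increments is used in full: off-diagonal terms
  vanish, and the equal diagonal terms add up to the squared norm of the position.
\<close>

lemma has_expectation_dot_square:
  fixes u :: "(nat \<Rightarrow> real) \<Rightarrow> 'b::{real_normed_field,banach,second_countable_topology}"
  assumes [measurable]: "u \<in> borel_measurable (borel_Rn p)"
    and int: "integrable M (\<lambda>\<omega>. u (S k \<omega>) * of_real ((norm_Rn p (S k \<omega>))\<^sup>2))"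
  shows "has_bochner_integral M (\<lambda>\<omega>. u (S k \<omega>) * of_real ((dot_Rn p (S k \<omega>) (X (Suc k) \<omega>))\<^sup>2))
           ((\<integral>\<omega>. u (S k \<omega>) * of_real ((norm_Rn p (S k \<omega>))\<^sup>2) \<partial>M) * of_real (\<sigma>\<^sup>2 / p))"
proof -
  have int2: "integrable M (\<lambda>\<omega>. u (S k \<omega>) * of_real (S k \<omega> i * S k \<omega> j))" if "i < p" "j < p" for i j
  proof (rule Bochner_Integration.integrable_bound[OF int])
    have [measurable]: "i \<in> {..<p}" "j \<in> {..<p}" using that by auto
    show "(\<lambda>\<omega>. u (S k \<omega>) * of_real (S k \<omega> i * S k \<omega> j)) \<in> borel_measurable M" by measurable
    show "AE \<omega> in M. norm (u (S k \<omega>) * of_real (S k \<omega> i * S k \<omega> j))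
            \<le> norm (u (S k \<omega>) * of_real ((norm_Rn p (S k \<omega>))\<^sup>2))"
      unfolding norm_mult norm_of_real power2_eq_square abs_mult
      using that by (intro AE_I2 mult_left_mono mult_mono) (auto intro: abs_component_le_norm_Rn)
  qed
  have cov: "(\<integral>\<omega>. of_real (X (Suc k) \<omega> i * X (Suc k) \<omega> j) \<partial>M) =
      (if i = j then of_real (\<sigma>\<^sup>2 / p) else 0 :: 'b)" if "i < p" "j < p" for i j
    using integral_bounded_linear[OF bounded_linear_of_real integrable_increment_components[of "Suc k" i j]]
      covariance[of "Suc k" i j] that by (cases "i = j") (simp_all del: of_real_mult of_real_power of_real_divide)
  have sq: "(dot_Rn p x h)\<^sup>2 = (\<Sum>i<p. \<Sum>j<p. (x i * x j) * (h i * h j))" for x h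
    by (simp add: dot_Rn_def power2_eq_square sum_product mult_ac)
  have "has_bochner_integral M
      (\<lambda>\<omega>. \<Sum>i<p. \<Sum>j<p. (u (S k \<omega>) * of_real (S k \<omega> i * S k \<omega> j)) * of_real (X (Suc k) \<omega> i * X (Suc k) \<omega> j))
      (\<Sum>i<p. \<Sum>j<p. (\<integral>\<omega>. u (S k \<omega>) * of_real (S k \<omega> i * S k \<omega> j) \<partial>M)
          * (\<integral>\<omega>. of_real (X (Suc k) \<omega> i * X (Suc k) \<omega> j) \<partial>M))"
  proof (intro has_bochner_integral_sum)
    fix i j assume ij: "i \<in> {..<p}" "j \<in> {..<p}"
    then have [measurable]: "i < p" "i \<in> {..<p}" "j < p" "j \<in> {..<p}" by auto
    show "has_bochner_integral M
        (\<lambda>\<omega>. u (S k \<omega>) * of_real (S k \<omega> i * S k \<omega> j) * of_real (X (Suc k) \<omega> i * X (Suc k) \<omega> j))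
        ((\<integral>\<omega>. u (S k \<omega>) * of_real (S k \<omega> i * S k \<omega> j) \<partial>M)
          * (\<integral>\<omega>. of_real (X (Suc k) \<omega> i * X (Suc k) \<omega> j) \<partial>M))"
    proof (rule has_expectation_product[where u = "\<lambda>x. u x * of_real (x i * x j)" and w = "\<lambda>h. of_real (h i * h j)"])
      show "integrable M (\<lambda>\<omega>. u (S k \<omega>) * of_real (S k \<omega> i * S k \<omega> j))"
        using ij by (intro int2) auto
      show "integrable M (\<lambda>\<omega>. of_real (X (Suc k) \<omega> i * X (Suc k) \<omega> j) :: 'b)"
        using ij by (intro integrable_bounded_linear[OF bounded_linear_of_real] integrable_increment_components) auto
    qed measurable
  qed
  also have "(\<lambda>\<omega>. \<Sum>i<p. \<Sum>j<p. (u (S k \<omega>) * of_real (S k \<omega> i * S k \<omega> j)) * of_real (X (Suc k) \<omega> i * X (Suc k) \<omega> j))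
      = (\<lambda>\<omega>. u (S k \<omega>) * of_real ((dot_Rn p (S k \<omega>) (X (Suc k) \<omega>))\<^sup>2))"
    by (simp only: sq of_real_sum sum_distrib_left of_real_mult mult.assoc)
  also have "(\<Sum>i<p. \<Sum>j<p. (\<integral>\<omega>. u (S k \<omega>) * of_real (S k \<omega> i * S k \<omega> j) \<partial>M)
          * (\<integral>\<omega>. of_real (X (Suc k) \<omega> i * X (Suc k) \<omega> j) \<partial>M))
      = (\<Sum>i<p. (\<integral>\<omega>. u (S k \<omega>) * of_real (S k \<omega> i * S k \<omega> i) \<partial>M) * of_real (\<sigma>\<^sup>2 / p))"
  proof (intro sum.cong refl)
    fix i assume i: "i \<in> {..<p}"
    have "(\<Sum>j<p. (\<integral>\<omega>. u (S k \<omega>) * of_real (S k \<omega> i * S k \<omega> j) \<partial>M)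
          * (\<integral>\<omega>. of_real (X (Suc k) \<omega> i * X (Suc k) \<omega> j) \<partial>M))
      = (\<Sum>j<p. if j = i then (\<integral>\<omega>. u (S k \<omega>) * of_real (S k \<omega> i * S k \<omega> i) \<partial>M) * of_real (\<sigma>\<^sup>2 / p) else 0)"
      using i by (intro sum.cong refl) (auto simp only: cov lessThan_iff mult_zero_right split: if_split)
    then show "(\<Sum>j<p. (\<integral>\<omega>. u (S k \<omega>) * of_real (S k \<omega> i * S k \<omega> j) \<partial>M)
          * (\<integral>\<omega>. of_real (X (Suc k) \<omega> i * X (Suc k) \<omega> j) \<partial>M))
      = (\<integral>\<omega>. u (S k \<omega>) * of_real (S k \<omega> i * S k \<omega> i) \<partial>M) * of_real (\<sigma>\<^sup>2 / p)"
      using i by simp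
  qed
  also have "\<dots> = (\<integral>\<omega>. (\<Sum>i<p. u (S k \<omega>) * of_real (S k \<omega> i * S k \<omega> i)) \<partial>M) * of_real (\<sigma>\<^sup>2 / p)"
    by (subst Bochner_Integration.integral_sum) (auto simp only: int2 lessThan_iff sum_distrib_right)
  also have "(\<lambda>\<omega>. \<Sum>i<p. u (S k \<omega>) * of_real (S k \<omega> i * S k \<omega> i))
      = (\<lambda>\<omega>. u (S k \<omega>) * of_real ((norm_Rn p (S k \<omega>))\<^sup>2))"
    by (simp only: norm_Rn_power2 of_real_sum sum_distrib_left) (simp only: power2_eq_square)
  finally show ?thesis .
qed

lemma has_expectation_centered_square:
  fixes u :: "(nat \<Rightarrow> real) \<Rightarrow> 'b::{real_normed_field,banach,second_countable_topology}"
  assumes [measurable]: "u \<in> borel_measurable (borel_Rn p)"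
    and "integrable M (\<lambda>\<omega>. u (S k \<omega>))"
  shows "has_bochner_integral M (\<lambda>\<omega>. u (S k \<omega>) * of_real ((norm_Rn p (X (Suc k) \<omega>))\<^sup>2 - \<sigma>\<^sup>2)) 0"
proof -
  have i: "integrable M (\<lambda>\<omega>. (norm_Rn p (X (Suc k) \<omega>))\<^sup>2 - \<sigma>\<^sup>2)"
    using integrable_increment_power[of "Suc k" 2] by simp
  have "has_bochner_integral M (\<lambda>\<omega>. u (S k \<omega>) * of_real ((norm_Rn p (X (Suc k) \<omega>))\<^sup>2 - \<sigma>\<^sup>2))
     ((\<integral>\<omega>. u (S k \<omega>) \<partial>M) * (\<integral>\<omega>. of_real ((norm_Rn p (X (Suc k) \<omega>))\<^sup>2 - \<sigma>\<^sup>2) \<partial>M))"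
    using assms(2) integrable_bounded_linear[OF bounded_linear_of_real i]
    by (intro has_expectation_product[where w = "\<lambda>h. of_real ((norm_Rn p h)\<^sup>2 - \<sigma>\<^sup>2)"]) auto
  moreover have "(\<integral>\<omega>. of_real ((norm_Rn p (X (Suc k) \<omega>))\<^sup>2 - \<sigma>\<^sup>2) \<partial>M) = (0::'b)"
    using integrable_increment_power[of "Suc k" 2] expectation_increment_square[of "Suc k"]
    by (subst integral_bounded_linear[OF bounded_linear_of_real i]) (simp add: prob_space)
  ultimately show ?thesis by simp
qed

lemma has_expectation_times_cube:
  fixes w :: "(nat \<Rightarrow> real) \<Rightarrow> real"
  assumes "w \<in> borel_measurable (borel_Rn p)" "integrable M (\<lambda>\<omega>. w (S k \<omega>))"
  shows "has_bochner_integral M (\<lambda>\<omega>. w (S k \<omega>) * (norm_Rn p (X (Suc k) \<omega>) + \<sigma>) ^ 3)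
           (expectation (\<lambda>\<omega>. w (S k \<omega>)) * m)"
  using has_expectation_product[OF assms(1) _ assms(2), of "\<lambda>h. (norm_Rn p h + \<sigma>) ^ 3"]
    integrable_cube[of "Suc k"] expectation_cube[of "Suc k"] by simp

lemma expectation_partial_sum_square: "expectation (\<lambda>\<omega>. (norm_Rn p (S k \<omega>))\<^sup>2) = k * \<sigma>\<^sup>2"
proof (induction k)
  case 0
  show ?case by (simp add: partial_sum_Rn_0)
next
  case (Suc k)
  have "has_bochner_integral M (\<lambda>\<omega>. dot_Rn p (S k \<omega>) (X (Suc k) \<omega>)) 0"
    using has_expectation_dot[of "\<lambda>_. 1 :: real" k] integrable_partial_sum_power[of 1 k] by simp
  then show ?case
    unfolding norm_Rn_partial_sum_Suc_power2
    using Suc integrable_partial_sum_power[of 2 k] integrable_increment_power[of "Suc k" 2]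
      expectation_increment_square[of "Suc k"]
    by (simp add: has_bochner_integral_iff algebra_simps)
qed

lemma expectation_partial_sum_norm_le: "expectation (\<lambda>\<omega>. norm_Rn p (S k \<omega>)) \<le> \<sigma> * sqrt k"
proof -
  have i: "integrable M (\<lambda>\<omega>. norm_Rn p (S k \<omega>))" "integrable M (\<lambda>\<omega>. (norm_Rn p (S k \<omega>))\<^sup>2)"
    using integrable_partial_sum_power[of 1 k] integrable_partial_sum_power[of 2 k] by auto
  have "0 \<le> variance (\<lambda>\<omega>. norm_Rn p (S k \<omega>))" by (rule variance_positive)
  also have "\<dots> = k * \<sigma>\<^sup>2 - (expectation (\<lambda>\<omega>. norm_Rn p (S k \<omega>)))\<^sup>2"
    using i by (subst variance_eq) (auto simp: expectation_partial_sum_square)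
  finally have "(expectation (\<lambda>\<omega>. norm_Rn p (S k \<omega>)))\<^sup>2 \<le> (\<sigma> * sqrt k)\<^sup>2"
    by (simp add: power_mult_distrib mult.commute)
  then show ?thesis by (rule power2_le_imp_le) (use sigma_pos in simp)
qed

text \<open>
  The term \<open>\<parallel>S\<^sub>k\<parallel> * \<langle>S\<^sub>k, X\<rangle>\<close> of \<open>cube_expansion_upper\<close> has mean zero, so a step increases the third moment
  by \<open>O(E \<parallel>S\<^sub>k\<parallel>) = O(sqrt n)\<close> only. The triangle inequality alone would give the order \<open>n\<^sup>3\<close>.
\<close>

lemma expectation_partial_sum_cube_le:
  fixes k n :: nat
  assumes "k \<le> n"
  shows "expectation (\<lambda>\<omega>. norm_Rn p (S k \<omega>) ^ 3) \<le> k * (3 * \<sigma> ^ 3 * sqrt n + m)"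
  using assms
proof (induction k)
  case 0
  show ?case by (simp add: partial_sum_Rn_0)
next
  case (Suc k)
  let ?a = "\<lambda>\<omega>. norm_Rn p (S k \<omega>)" and ?h = "\<lambda>\<omega>. norm_Rn p (X (Suc k) \<omega>)"
    and ?d = "\<lambda>\<omega>. dot_Rn p (S k \<omega>) (X (Suc k) \<omega>)"
  have i1: "integrable M ?a" "integrable M (\<lambda>\<omega>. ?a \<omega> ^ 3)" "integrable M (\<lambda>\<omega>. ?h \<omega> ^ 3)"
    using integrable_partial_sum_power[of 1 k] integrable_partial_sum_power[of 3 k]
      integrable_increment_power[of "Suc k" 3] by auto
  have ad: "has_bochner_integral M (\<lambda>\<omega>. ?a \<omega> * ?d \<omega>) 0"
    using has_expectation_dot[of "norm_Rn p" k] integrable_partial_sum_power[of 2 k]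
    by (simp add: power2_eq_square)
  have ah: "has_bochner_integral M (\<lambda>\<omega>. ?a \<omega> * (?h \<omega>)\<^sup>2) (expectation ?a * \<sigma>\<^sup>2)"
    using has_expectation_product[of "norm_Rn p" "\<lambda>h. (norm_Rn p h)\<^sup>2" k] i1(1)
      integrable_increment_power[of "Suc k" 2] expectation_increment_square[of "Suc k"] by simp
  have le: "norm_Rn p (S (Suc k) \<omega>) ^ 3
      \<le> ?a \<omega> ^ 3 + 3 * (?a \<omega> * ?d \<omega>) + 3 * (?a \<omega> * (?h \<omega>)\<^sup>2) + ?h \<omega> ^ 3" for \<omega>
    using cube_expansion_upper[OF _ _ norm_Rn_partial_sum_Suc_triangle[of p X k \<omega>]]
    unfolding norm_Rn_partial_sum_Suc_power2
    by (simp add: algebra_simps power2_eq_square power3_eq_cube)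
  have "expectation (\<lambda>\<omega>. norm_Rn p (S (Suc k) \<omega>) ^ 3)
      \<le> expectation (\<lambda>\<omega>. ?a \<omega> ^ 3 + 3 * (?a \<omega> * ?d \<omega>) + 3 * (?a \<omega> * (?h \<omega>)\<^sup>2) + ?h \<omega> ^ 3)"
    using ad ah i1 le integrable_partial_sum_power[of 3 "Suc k"]
    by (intro integral_mono) (auto simp: has_bochner_integral_iff)
  also have "\<dots> = expectation (\<lambda>\<omega>. ?a \<omega> ^ 3) + 3 * (expectation ?a * \<sigma>\<^sup>2) + expectation (\<lambda>\<omega>. ?h \<omega> ^ 3)"
    using ad ah i1 by (simp add: has_bochner_integral_iff)
  also have "\<dots> \<le> k * (3 * \<sigma> ^ 3 * sqrt n + m) + 3 * (\<sigma> * sqrt n * \<sigma>\<^sup>2) + m"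
  proof (intro add_mono mult_left_mono mult_right_mono)
    have "\<sigma> * sqrt k \<le> \<sigma> * sqrt n" using Suc.prems sigma_pos by simp
    then show "expectation ?a \<le> \<sigma> * sqrt n"
      using expectation_partial_sum_norm_le[of k] by linarith
  qed (use Suc expectation_increment_cube_le[of "Suc k"] in auto)
  also have "\<dots> = Suc k * (3 * \<sigma> ^ 3 * sqrt n + m)"
    by (simp add: algebra_simps power2_eq_square power3_eq_cube)
  finally show ?case .
qed

definition excess :: "real \<Rightarrow> nat \<Rightarrow> 'a \<Rightarrow> real" where
  "excess c k \<omega> = c * ((norm_Rn p (S k \<omega>))\<^sup>2 - k * \<sigma>\<^sup>2)"

lemma excess_measurable [measurable]: "excess c k \<in> borel_measurable M"
  unfolding excess_def by measurable

lemma excess_0: "excess c 0 \<omega> = 0"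
  by (simp add: excess_def partial_sum_Rn_0)

lemma excess_Suc: "excess c (Suc k) \<omega> = excess c k \<omega> + (2 * c * dot_Rn p (S k \<omega>) (X (Suc k) \<omega>)
    + c * ((norm_Rn p (X (Suc k) \<omega>))\<^sup>2 - \<sigma>\<^sup>2))"
  unfolding excess_def norm_Rn_partial_sum_Suc_power2 by (simp add: algebra_simps)

lemma integrable_excess: "integrable M (excess c k)"
  unfolding excess_def using integrable_partial_sum_power[of 2 k] by simp

lemma integrable_soft_abs_excess: "integrable M (\<lambda>\<omega>. sqrt (1 + (excess c k \<omega>)\<^sup>2))"
proof (rule Bochner_Integration.integrable_bound)
  show "integrable M (\<lambda>\<omega>. 1 + \<bar>excess c k \<omega>\<bar>)" using integrable_excess by simp
  show "AE \<omega> in M. norm (sqrt (1 + (excess c k \<omega>)\<^sup>2)) \<le> norm (1 + \<bar>excess c k \<omega>\<bar>)"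
    using sqrt_sum_squares_le_sum_abs[of 1] by (intro AE_I2) simp
qed measurable

text \<open>
  The weight \<open>u\<close> is the derivative of \<open>sqrt (1 + t\<^sup>2)\<close> at the current excess. The first-order terms
  average out, and isotropy evaluates the quadratic one.
\<close>

lemma expectation_soft_abs_excess_Suc:
  assumes "0 \<le> c"
  shows "expectation (\<lambda>\<omega>. sqrt (1 + (excess c (Suc k) \<omega>)\<^sup>2))
     \<le> expectation (\<lambda>\<omega>. sqrt (1 + (excess c k \<omega>)\<^sup>2)) + 2 * c\<^sup>2 * \<sigma> ^ 4 * k / p
       + (2 * c\<^sup>2 * (\<sigma> * sqrt k) + c * sqrt c) * m"
proof -
  define u where "u x = (c * ((norm_Rn p x)\<^sup>2 - k * \<sigma>\<^sup>2)) /
    sqrt (1 + (c * ((norm_Rn p x)\<^sup>2 - k * \<sigma>\<^sup>2))\<^sup>2)" for x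
  have [measurable]: "u \<in> borel_measurable (borel_Rn p)"
    unfolding u_def by measurable
  have u_le: "\<bar>u x\<bar> \<le> 1" for x
    unfolding u_def by (rule abs_div_sqrt_one_plus_square_le_1)
  have uT: "u (S k \<omega>) = excess c k \<omega> / sqrt (1 + (excess c k \<omega>)\<^sup>2)" for \<omega>
    unfolding u_def excess_def ..
  let ?r = "\<lambda>\<omega>. norm_Rn p (S k \<omega>)" and ?h = "\<lambda>\<omega>. norm_Rn p (X (Suc k) \<omega>)"
    and ?d = "\<lambda>\<omega>. dot_Rn p (S k \<omega>) (X (Suc k) \<omega>)"
  have ir: "integrable M ?r" "integrable M (\<lambda>\<omega>. (?r \<omega>)\<^sup>2)"
    using integrable_partial_sum_power[of 1 k] integrable_partial_sum_power[of 2 k] by auto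
  have iu: "integrable M (\<lambda>\<omega>. u (S k \<omega>))"
    by (rule integrable_const_bound[where B = 1]) (use u_le in auto)
  have iur: "integrable M (\<lambda>\<omega>. u (S k \<omega>) * ?r \<omega>)"
  proof (rule Bochner_Integration.integrable_bound[OF ir(1)])
    show "AE \<omega> in M. norm (u (S k \<omega>) * ?r \<omega>) \<le> norm (?r \<omega>)"
      using mult_right_mono[OF u_le] by (intro AE_I2) (simp add: abs_mult)
  qed measurable
  have d: "has_bochner_integral M (\<lambda>\<omega>. u (S k \<omega>) * ?d \<omega>) 0"
    using has_expectation_dot[of u k] iur by simp
  have b: "has_bochner_integral M (\<lambda>\<omega>. u (S k \<omega>) * ((?h \<omega>)\<^sup>2 - \<sigma>\<^sup>2)) 0"
    using has_expectation_centered_square[of u k] iu by simp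
  have dd: "has_bochner_integral M (\<lambda>\<omega>. (?d \<omega>)\<^sup>2) (k * \<sigma>\<^sup>2 * (\<sigma>\<^sup>2 / p))"
    using has_expectation_dot_square[of "\<lambda>_. 1 :: real" k] ir
    by (simp add: expectation_partial_sum_square)
  have e: "has_bochner_integral M (\<lambda>\<omega>. (2 * c\<^sup>2 * ?r \<omega> + c * sqrt c) * (?h \<omega> + \<sigma>) ^ 3)
      ((2 * c\<^sup>2 * expectation ?r + c * sqrt c) * m)"
    using has_expectation_times_cube[of "\<lambda>x. 2 * c\<^sup>2 * norm_Rn p x + c * sqrt c" k] ir
    by (simp add: prob_space)
  let ?g = "\<lambda>\<omega>. sqrt (1 + (excess c k \<omega>)\<^sup>2) + 2 * c * (u (S k \<omega>) * ?d \<omega>)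
      + c * (u (S k \<omega>) * ((?h \<omega>)\<^sup>2 - \<sigma>\<^sup>2)) + 2 * c\<^sup>2 * (?d \<omega>)\<^sup>2
      + (2 * c\<^sup>2 * ?r \<omega> + c * sqrt c) * (?h \<omega> + \<sigma>) ^ 3"
  have g: "has_bochner_integral M ?g
     (expectation (\<lambda>\<omega>. sqrt (1 + (excess c k \<omega>)\<^sup>2)) + 2 * c * 0 + c * 0 + 2 * c\<^sup>2 * (k * \<sigma>\<^sup>2 * (\<sigma>\<^sup>2 / p))
      + (2 * c\<^sup>2 * expectation ?r + c * sqrt c) * m)"
    using integrable_soft_abs_excess
    by (intro has_bochner_integral_add has_bochner_integral_mult_right d b dd e)
       (auto simp: has_bochner_integral_iff)
  have "expectation (\<lambda>\<omega>. sqrt (1 + (excess c (Suc k) \<omega>)\<^sup>2)) \<le> expectation ?g"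
  proof (rule integral_mono[OF integrable_soft_abs_excess])
    show "integrable M ?g" using g by (simp add: has_bochner_integral_iff)
    fix \<omega>
    note err = increment_error_bounds[of c \<sigma> "?r \<omega>" "?h \<omega>" "?d \<omega>"]
    have "sqrt (1 + (excess c (Suc k) \<omega>)\<^sup>2) \<le> sqrt (1 + (excess c k \<omega>)\<^sup>2)
      + u (S k \<omega>) * (2 * c * ?d \<omega> + c * ((?h \<omega>)\<^sup>2 - \<sigma>\<^sup>2))
      + ((2 * c * ?d \<omega>)\<^sup>2 / 2 + \<bar>2 * c * ?d \<omega>\<bar> * \<bar>c * ((?h \<omega>)\<^sup>2 - \<sigma>\<^sup>2)\<bar>
         + \<bar>c * ((?h \<omega>)\<^sup>2 - \<sigma>\<^sup>2)\<bar> * sqrt \<bar>c * ((?h \<omega>)\<^sup>2 - \<sigma>\<^sup>2)\<bar>)"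
      unfolding excess_Suc uT by (rule sqrt_one_plus_square_expansion_mixed)
    also have "\<dots> \<le> sqrt (1 + (excess c k \<omega>)\<^sup>2)
      + u (S k \<omega>) * (2 * c * ?d \<omega> + c * ((?h \<omega>)\<^sup>2 - \<sigma>\<^sup>2))
      + ((2 * c * ?d \<omega>)\<^sup>2 / 2 + 2 * c\<^sup>2 * ?r \<omega> * (?h \<omega> + \<sigma>) ^ 3 + c * sqrt c * (?h \<omega> + \<sigma>) ^ 3)"
      using assms sigma_pos by (intro add_left_mono add_mono order_refl err abs_dot_Rn_le) auto
    also have "\<dots> = ?g \<omega>" by (simp add: algebra_simps power2_eq_square)
    finally show "sqrt (1 + (excess c (Suc k) \<omega>)\<^sup>2) \<le> ?g \<omega>" .
  qed
  also have "\<dots> = expectation (\<lambda>\<omega>. sqrt (1 + (excess c k \<omega>)\<^sup>2)) + 2 * c\<^sup>2 * \<sigma> ^ 4 * k / p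
      + (2 * c\<^sup>2 * expectation ?r + c * sqrt c) * m"
    using g by (simp add: has_bochner_integral_iff power4_eq_xxxx power2_eq_square mult_ac)
  also have "\<dots> \<le> expectation (\<lambda>\<omega>. sqrt (1 + (excess c k \<omega>)\<^sup>2)) + 2 * c\<^sup>2 * \<sigma> ^ 4 * k / p
      + (2 * c\<^sup>2 * (\<sigma> * sqrt k) + c * sqrt c) * m"
    by (intro add_left_mono mult_right_mono add_right_mono mult_left_mono
          expectation_partial_sum_norm_le m_nonneg) auto
  finally show ?thesis .
qed

text \<open>
  For the relevant \<open>c\<close> one has \<open>2 * c\<^sup>2 * \<sigma>\<^sup>4 / p = 1 / n\<^sup>2\<close>, so the first term in the sum contributes \<open>1\<close>;
  the second contributes a quantity that tends to zero.
\<close>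

lemma expectation_abs_excess_le:
  fixes k n :: nat
  assumes "0 \<le> c" "k \<le> n"
  shows "expectation (\<lambda>\<omega>. \<bar>excess c k \<omega>\<bar>)
     \<le> 1 + n * (2 * c\<^sup>2 * \<sigma> ^ 4 * n / p + (2 * c\<^sup>2 * (\<sigma> * sqrt n) + c * sqrt c) * m)"
proof -
  let ?D = "2 * c\<^sup>2 * \<sigma> ^ 4 * n / p + (2 * c\<^sup>2 * (\<sigma> * sqrt n) + c * sqrt c) * m"
  have soft: "expectation (\<lambda>\<omega>. sqrt (1 + (excess c k \<omega>)\<^sup>2)) \<le> 1 + k * ?D"
    using assms(2)
  proof (induction k)
    case 0
    show ?case by (simp add: excess_0 prob_space)
  next
    case (Suc k)
    have "2 * c\<^sup>2 * \<sigma> ^ 4 * k / p \<le> 2 * c\<^sup>2 * \<sigma> ^ 4 * n / p"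
      using Suc.prems by (intro divide_right_mono mult_left_mono) auto
    moreover have "(2 * c\<^sup>2 * (\<sigma> * sqrt k) + c * sqrt c) * m \<le> (2 * c\<^sup>2 * (\<sigma> * sqrt n) + c * sqrt c) * m"
      using Suc.prems sigma_pos
      by (intro mult_right_mono add_right_mono mult_left_mono m_nonneg) auto
    ultimately show ?case
      using expectation_soft_abs_excess_Suc[OF assms(1), of k] Suc.IH[OF Suc_leD[OF Suc.prems]]
      by (simp only: of_nat_Suc distrib_right[of 1] mult_1_left)
  qed
  have "?D \<ge> 0" using assms sigma_pos m_nonneg by auto
  then have "k * ?D \<le> n * ?D" using assms by (intro mult_right_mono) auto
  moreover have "expectation (\<lambda>\<omega>. \<bar>excess c k \<omega>\<bar>) \<le> expectation (\<lambda>\<omega>. sqrt (1 + (excess c k \<omega>)\<^sup>2))"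
    by (intro integral_mono integrable_abs integrable_excess integrable_soft_abs_excess)
       (auto intro: real_le_rsqrt)
  ultimately show ?thesis using soft by linarith
qed

definition walk_char :: "real \<Rightarrow> real \<Rightarrow> nat \<Rightarrow> complex" where
  "walk_char c s k = (CLINT \<omega>|M. iexp (s * excess c k \<omega>))"

lemma integrable_iexp_excess: "integrable M (\<lambda>\<omega>. iexp (s * excess c k \<omega>))"
  by (rule integrable_const_bound[where B = 1]) auto

lemma walk_char_0: "walk_char c s 0 = 1"
  by (simp add: walk_char_def excess_0 prob_space)

lemma cmod_walk_char_le_1: "cmod (walk_char c s k) \<le> 1"
proof -
  have "cmod (walk_char c s k) \<le> expectation (\<lambda>\<omega>. cmod (iexp (s * excess c k \<omega>)))"
    unfolding walk_char_def by (rule integral_norm_bound)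
  then show ?thesis by (simp add: prob_space)
qed

text \<open>
  The quadratic term of the expansion has the expectation of \<open>exp (i * s * T\<^sub>k) * \<parallel>S\<^sub>k\<parallel>\<^sup>2\<close> as a factor.
  Splitting \<open>\<parallel>S\<^sub>k\<parallel>\<^sup>2 = k * \<sigma>\<^sup>2 + T\<^sub>k / c\<close> closes the recursion, at the price of the first error term.
\<close>

lemma walk_char_Suc:
  assumes "0 < c"
  shows "cmod (walk_char c s (Suc k) - (1 - of_real (2 * s\<^sup>2 * c\<^sup>2 * \<sigma> ^ 4 * k / p)) * walk_char c s k)
     \<le> 2 * s\<^sup>2 * c * \<sigma>\<^sup>2 / p * expectation (\<lambda>\<omega>. \<bar>excess c k \<omega>\<bar>)
       + (4 / 3 * \<bar>s\<bar> ^ 3 * c ^ 3 * expectation (\<lambda>\<omega>. norm_Rn p (S k \<omega>) ^ 3)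
          + 2 * s\<^sup>2 * c\<^sup>2 * expectation (\<lambda>\<omega>. norm_Rn p (S k \<omega>)) + \<bar>s\<bar> * sqrt \<bar>s\<bar> * (c * sqrt c)) * m"
proof -
  let ?r = "\<lambda>\<omega>. norm_Rn p (S k \<omega>)" and ?h = "\<lambda>\<omega>. norm_Rn p (X (Suc k) \<omega>)"
    and ?d = "\<lambda>\<omega>. dot_Rn p (S k \<omega>) (X (Suc k) \<omega>)"
  define u where "u x = iexp (s * (c * ((norm_Rn p x)\<^sup>2 - k * \<sigma>\<^sup>2)))" for x
  have [measurable]: "u \<in> borel_measurable (borel_Rn p)"
    unfolding u_def by measurable
  have uT: "u (S k \<omega>) = iexp (s * excess c k \<omega>)" for \<omega>
    unfolding u_def excess_def ..
  have u_norm: "cmod (u x) = 1" for x unfolding u_def by simp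
  have ir: "integrable M (\<lambda>\<omega>. ?r \<omega> ^ e)" if "e \<le> 3" for e
    by (rule integrable_partial_sum_power[OF that])
  have iu: "integrable M (\<lambda>\<omega>. u (S k \<omega>))" unfolding uT by (rule integrable_iexp_excess)
  have iur: "integrable M (\<lambda>\<omega>. u (S k \<omega>) * of_real (?r \<omega> ^ e))" if "e \<le> 3" for e
    by (rule Bochner_Integration.integrable_bound[OF ir[OF that]])
       (auto simp: norm_mult u_norm norm_power)
  have iuT: "integrable M (\<lambda>\<omega>. u (S k \<omega>) * of_real (excess c k \<omega>))"
    by (rule Bochner_Integration.integrable_bound[OF integrable_excess[of c k]])
       (auto simp: norm_mult u_norm)
  have d: "has_bochner_integral M (\<lambda>\<omega>. u (S k \<omega>) * of_real (?d \<omega>)) 0"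
    using has_expectation_dot[of u k] iur[of 1] by simp
  have b: "has_bochner_integral M (\<lambda>\<omega>. u (S k \<omega>) * of_real ((?h \<omega>)\<^sup>2 - \<sigma>\<^sup>2)) 0"
    using iu by (intro has_expectation_centered_square) auto
  have dd: "has_bochner_integral M (\<lambda>\<omega>. u (S k \<omega>) * of_real ((?d \<omega>)\<^sup>2))
      ((\<integral>\<omega>. u (S k \<omega>) * of_real ((?r \<omega>)\<^sup>2) \<partial>M) * of_real (\<sigma>\<^sup>2 / p))"
    using has_expectation_dot_square[of u k] iur[of 2] by simp
  \<comment> \<open>the effect of the deviation of the squared norm from its mean\<close>
  define J where "J = (\<integral>\<omega>. u (S k \<omega>) * of_real (excess c k \<omega>) \<partial>M)"
  have J: "cmod J \<le> expectation (\<lambda>\<omega>. \<bar>excess c k \<omega>\<bar>)"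
    using integral_norm_bound[of M "\<lambda>\<omega>. u (S k \<omega>) * of_real (excess c k \<omega>)"]
    unfolding J_def by (simp add: norm_mult u_norm)
  have walk_char: "walk_char c s k = (\<integral>\<omega>. u (S k \<omega>) \<partial>M)" unfolding walk_char_def uT ..
  have "(\<integral>\<omega>. u (S k \<omega>) * of_real ((?r \<omega>)\<^sup>2) \<partial>M)
      = (\<integral>\<omega>. of_real (1 / c) * (u (S k \<omega>) * of_real (excess c k \<omega>)) + of_real (k * \<sigma>\<^sup>2) * u (S k \<omega>) \<partial>M)"
    using assms by (intro Bochner_Integration.integral_cong) (auto simp: excess_def field_simps)
  also have "\<dots> = of_real (1 / c) * J + of_real (k * \<sigma>\<^sup>2) * walk_char c s k"
    unfolding J_def walk_char using iu iuT by simp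
  finally have r2: "(\<integral>\<omega>. u (S k \<omega>) * of_real ((?r \<omega>)\<^sup>2) \<partial>M)
      = of_real (1 / c) * J + of_real (k * \<sigma>\<^sup>2) * walk_char c s k" .
  let ?a = "\<lambda>\<omega>. 2 * c * ?d \<omega>" and ?b = "\<lambda>\<omega>. c * ((?h \<omega>)\<^sup>2 - \<sigma>\<^sup>2)"
  \<comment> \<open>the expansion of the next value, without the remainder\<close>
  let ?Y = "\<lambda>\<omega>. u (S k \<omega>) + \<i> * of_real (2 * s * c) * (u (S k \<omega>) * of_real (?d \<omega>))
      + \<i> * of_real (s * c) * (u (S k \<omega>) * of_real ((?h \<omega>)\<^sup>2 - \<sigma>\<^sup>2))
      + of_real (- (2 * s\<^sup>2 * c\<^sup>2)) * (u (S k \<omega>) * of_real ((?d \<omega>)\<^sup>2))"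
  have Y: "has_bochner_integral M ?Y (walk_char c s k + \<i> * of_real (2 * s * c) * 0 + \<i> * of_real (s * c) * 0
      + of_real (- (2 * s\<^sup>2 * c\<^sup>2)) * ((of_real (1 / c) * J + of_real (k * \<sigma>\<^sup>2) * walk_char c s k) * of_real (\<sigma>\<^sup>2 / p)))"
    using iu dd unfolding r2
    by (intro has_bochner_integral_add has_bochner_integral_mult_right d b)
       (auto simp: has_bochner_integral_iff walk_char)
  let ?w = "\<lambda>x. 4 / 3 * \<bar>s\<bar> ^ 3 * c ^ 3 * norm_Rn p x ^ 3 + 2 * s\<^sup>2 * c\<^sup>2 * norm_Rn p x
      + \<bar>s\<bar> * sqrt \<bar>s\<bar> * (c * sqrt c)"
  have e: "has_bochner_integral M (\<lambda>\<omega>. ?w (S k \<omega>) * (?h \<omega> + \<sigma>) ^ 3)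
      ((4 / 3 * \<bar>s\<bar> ^ 3 * c ^ 3 * expectation (\<lambda>\<omega>. ?r \<omega> ^ 3) + 2 * s\<^sup>2 * c\<^sup>2 * expectation ?r
      + \<bar>s\<bar> * sqrt \<bar>s\<bar> * (c * sqrt c)) * m)"
    using has_expectation_times_cube[of ?w k] ir[of 3] ir[of 1]
    by (simp add: prob_space)
  have pointwise: "cmod (iexp (s * excess c (Suc k) \<omega>) - ?Y \<omega>) \<le> ?w (S k \<omega>) * (?h \<omega> + \<sigma>) ^ 3" for \<omega>
  proof -
    note err = increment_error_bounds[of c \<sigma> "?r \<omega>" "?h \<omega>" "?d \<omega>"]
    have e1: "iexp (s * excess c (Suc k) \<omega>) = u (S k \<omega>) * iexp (s * ?a \<omega> + s * ?b \<omega>)"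
      unfolding uT excess_Suc by (simp add: distrib_left flip: exp_add)
    have "iexp (s * excess c (Suc k) \<omega>) - ?Y \<omega> = u (S k \<omega>) * (iexp (s * ?a \<omega> + s * ?b \<omega>)
        - (1 + \<i> * of_real (s * ?a \<omega> + s * ?b \<omega>) - of_real ((s * ?a \<omega>)\<^sup>2 / 2)))"
      unfolding e1 by (simp add: algebra_simps power2_eq_square)
    then have "cmod (iexp (s * excess c (Suc k) \<omega>) - ?Y \<omega>) = cmod (iexp (s * ?a \<omega> + s * ?b \<omega>)
        - (1 + \<i> * of_real (s * ?a \<omega> + s * ?b \<omega>) - of_real ((s * ?a \<omega>)\<^sup>2 / 2)))"
      by (simp only: norm_mult u_norm mult_1_left)
    also have "\<dots> \<le> \<bar>s * ?a \<omega>\<bar> ^ 3 / 6 + \<bar>s * ?a \<omega>\<bar> * \<bar>s * ?b \<omega>\<bar> + \<bar>s * ?b \<omega>\<bar> * sqrt \<bar>s * ?b \<omega>\<bar>"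
      by (rule iexp_expansion_mixed)
    also have "\<dots> = \<bar>s\<bar> ^ 3 / 6 * \<bar>?a \<omega>\<bar> ^ 3 + s\<^sup>2 * (\<bar>?a \<omega>\<bar> * \<bar>?b \<omega>\<bar>)
        + \<bar>s\<bar> * sqrt \<bar>s\<bar> * (\<bar>?b \<omega>\<bar> * sqrt \<bar>?b \<omega>\<bar>)"
      by (simp only: abs_mult power_mult_distrib real_sqrt_mult flip: power2_abs[of s])
         (simp add: power2_eq_square mult_ac)
    also have "\<dots> \<le> \<bar>s\<bar> ^ 3 / 6 * (8 * c ^ 3 * ?r \<omega> ^ 3 * (?h \<omega> + \<sigma>) ^ 3)
        + s\<^sup>2 * (2 * c\<^sup>2 * ?r \<omega> * (?h \<omega> + \<sigma>) ^ 3)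
        + \<bar>s\<bar> * sqrt \<bar>s\<bar> * (c * sqrt c * (?h \<omega> + \<sigma>) ^ 3)"
      using assms sigma_pos by (intro add_mono mult_left_mono err abs_dot_Rn_le) auto
    also have "\<dots> = ?w (S k \<omega>) * (?h \<omega> + \<sigma>) ^ 3" by (simp add: field_simps)
    finally show ?thesis .
  qed
  have iY: "integrable M ?Y" and i1: "integrable M (\<lambda>\<omega>. iexp (s * excess c (Suc k) \<omega>))"
    using Y integrable_iexp_excess by (auto simp: has_bochner_integral_iff)
  have "(\<integral>\<omega>. ?Y \<omega> \<partial>M) = walk_char c s k - of_real (2 * s\<^sup>2 * c\<^sup>2 * (1 / c) * (\<sigma>\<^sup>2 / p)) * J
      - of_real (2 * s\<^sup>2 * c\<^sup>2 * (k * \<sigma>\<^sup>2) * (\<sigma>\<^sup>2 / p)) * walk_char c s k"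
    by (rule trans[OF has_bochner_integral_integral_eq[OF Y]],
        simp only: of_real_mult of_real_minus algebra_simps, simp)
  moreover have "2 * s\<^sup>2 * c\<^sup>2 * (1 / c) * (\<sigma>\<^sup>2 / p) = 2 * s\<^sup>2 * c * \<sigma>\<^sup>2 / p"
    using assms by (simp add: power2_eq_square)
  moreover have "2 * s\<^sup>2 * c\<^sup>2 * (k * \<sigma>\<^sup>2) * (\<sigma>\<^sup>2 / p) = 2 * s\<^sup>2 * c\<^sup>2 * \<sigma> ^ 4 * k / p"
    by (simp add: power4_eq_xxxx power2_eq_square)
  ultimately have "(\<integral>\<omega>. ?Y \<omega> \<partial>M) = walk_char c s k - of_real (2 * s\<^sup>2 * c * \<sigma>\<^sup>2 / p) * J
      - of_real (2 * s\<^sup>2 * c\<^sup>2 * \<sigma> ^ 4 * k / p) * walk_char c s k"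
    by (simp only:)
  then have "walk_char c s (Suc k) - (1 - of_real (2 * s\<^sup>2 * c\<^sup>2 * \<sigma> ^ 4 * k / p)) * walk_char c s k
      = (walk_char c s (Suc k) - (\<integral>\<omega>. ?Y \<omega> \<partial>M)) - of_real (2 * s\<^sup>2 * c * \<sigma>\<^sup>2 / p) * J"
    by (simp only: left_diff_distrib mult_1_left) simp
  then have "cmod (walk_char c s (Suc k) - (1 - of_real (2 * s\<^sup>2 * c\<^sup>2 * \<sigma> ^ 4 * k / p)) * walk_char c s k)
      \<le> cmod (walk_char c s (Suc k) - (\<integral>\<omega>. ?Y \<omega> \<partial>M)) + cmod (of_real (2 * s\<^sup>2 * c * \<sigma>\<^sup>2 / p) * J)"
    by (simp only: norm_triangle_ineq4)
  also have "\<dots> \<le> (4 / 3 * \<bar>s\<bar> ^ 3 * c ^ 3 * expectation (\<lambda>\<omega>. ?r \<omega> ^ 3) + 2 * s\<^sup>2 * c\<^sup>2 * expectation ?r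
      + \<bar>s\<bar> * sqrt \<bar>s\<bar> * (c * sqrt c)) * m
      + 2 * s\<^sup>2 * c * \<sigma>\<^sup>2 / p * expectation (\<lambda>\<omega>. \<bar>excess c k \<omega>\<bar>)"
  proof (rule add_mono)
    have "cmod (of_real (2 * s\<^sup>2 * c * \<sigma>\<^sup>2 / p) * J) = 2 * s\<^sup>2 * c * \<sigma>\<^sup>2 / p * cmod J"
      using assms by (simp only: norm_mult norm_of_real) simp
    also have "\<dots> \<le> 2 * s\<^sup>2 * c * \<sigma>\<^sup>2 / p * expectation (\<lambda>\<omega>. \<bar>excess c k \<omega>\<bar>)"
      using assms by (intro mult_left_mono J) auto
    finally show "cmod (of_real (2 * s\<^sup>2 * c * \<sigma>\<^sup>2 / p) * J)
        \<le> 2 * s\<^sup>2 * c * \<sigma>\<^sup>2 / p * expectation (\<lambda>\<omega>. \<bar>excess c k \<omega>\<bar>)" .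
    have "walk_char c s (Suc k) - (\<integral>\<omega>. ?Y \<omega> \<partial>M) = (\<integral>\<omega>. iexp (s * excess c (Suc k) \<omega>) - ?Y \<omega> \<partial>M)"
      unfolding walk_char_def by (rule Bochner_Integration.integral_diff[OF i1 iY, symmetric])
    then have "cmod (walk_char c s (Suc k) - (\<integral>\<omega>. ?Y \<omega> \<partial>M))
        \<le> expectation (\<lambda>\<omega>. cmod (iexp (s * excess c (Suc k) \<omega>) - ?Y \<omega>))"
      by (simp only: integral_norm_bound)
    also have "\<dots> \<le> expectation (\<lambda>\<omega>. ?w (S k \<omega>) * (?h \<omega> + \<sigma>) ^ 3)"
    proof (rule integral_mono)
      show "integrable M (\<lambda>\<omega>. cmod (iexp (s * excess c (Suc k) \<omega>) - ?Y \<omega>))"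
        by (rule integrable_norm[OF Bochner_Integration.integrable_diff[OF i1 iY]])
      show "integrable M (\<lambda>\<omega>. ?w (S k \<omega>) * (?h \<omega> + \<sigma>) ^ 3)"
        using e by (rule has_bochner_integral_iff[THEN iffD1, THEN conjunct1])
    qed (rule pointwise)
    also have "\<dots> = (4 / 3 * \<bar>s\<bar> ^ 3 * c ^ 3 * expectation (\<lambda>\<omega>. ?r \<omega> ^ 3) + 2 * s\<^sup>2 * c\<^sup>2 * expectation ?r
        + \<bar>s\<bar> * sqrt \<bar>s\<bar> * (c * sqrt c)) * m"
      by (rule has_bochner_integral_integral_eq[OF e])
    finally show "cmod (walk_char c s (Suc k) - (\<integral>\<omega>. ?Y \<omega> \<partial>M))
        \<le> (4 / 3 * \<bar>s\<bar> ^ 3 * c ^ 3 * expectation (\<lambda>\<omega>. ?r \<omega> ^ 3) + 2 * s\<^sup>2 * c\<^sup>2 * expectation ?r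
        + \<bar>s\<bar> * sqrt \<bar>s\<bar> * (c * sqrt c)) * m" .
  qed
  finally show ?thesis by linarith
qed

text \<open>
  Each step multiplies by \<open>exp (- s\<^sup>2 * k / n\<^sup>2)\<close> up to an error that does not depend on \<open>k\<close>. These factors
  are at most \<open>1\<close>, so the errors of the \<open>n\<close> steps just add up.
\<close>

lemma walk_char_approx:
  fixes s :: real and n :: nat
  assumes "n \<ge> 1"
  defines "c \<equiv> scaling \<sigma> p n"
  shows "cmod (walk_char c s n - of_real (exp (- (s\<^sup>2 * (real n - 1) / (2 * real n)))))
    \<le> walk_char_error \<sigma> m p n s"
proof -
  let ?E = "2 * s\<^sup>2 * c * \<sigma>\<^sup>2 / p * (2 + n * ((2 * c\<^sup>2 * (\<sigma> * sqrt n) + c * sqrt c) * m))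
      + (4 / 3 * \<bar>s\<bar> ^ 3 * c ^ 3 * (n * (3 * \<sigma> ^ 3 * sqrt n + m))
          + 2 * s\<^sup>2 * c\<^sup>2 * (\<sigma> * sqrt n) + \<bar>s\<bar> * sqrt \<bar>s\<bar> * (c * sqrt c)) * m"
  have c: "c > 0" unfolding c_def scaling_def using assms p_pos sigma_pos by simp
  have "c\<^sup>2 = p / (2 * n\<^sup>2 * \<sigma> ^ 4)"
    unfolding c_def scaling_def by (simp add: power_divide power_mult_distrib mult_ac)
  then have c2: "2 * c\<^sup>2 * \<sigma> ^ 4 / p = 1 / n\<^sup>2"
    using assms p_pos sigma_pos by (simp add: field_simps)
  define z where "z k = s\<^sup>2 * k / n\<^sup>2" for k :: nat
  have z: "0 \<le> z k" for k unfolding z_def by simp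
  have step: "cmod (walk_char c s (Suc k) - of_real (exp (- z k)) * walk_char c s k) \<le> ?E + s ^ 4 / n\<^sup>2" if "k \<le> n" for k
  proof -
    have zk: "2 * s\<^sup>2 * c\<^sup>2 * \<sigma> ^ 4 * k / p = z k"
      using arg_cong[OF c2, of "\<lambda>y. s\<^sup>2 * k * y"] unfolding z_def by (simp add: mult_ac)
    have "n * (2 * c\<^sup>2 * \<sigma> ^ 4 * n / p) = n\<^sup>2 * (2 * c\<^sup>2 * \<sigma> ^ 4 / p)"
      by (simp add: power2_eq_square)
    also have "\<dots> = 1" unfolding c2 using assms by simp
    finally have excess: "expectation (\<lambda>\<omega>. \<bar>excess c k \<omega>\<bar>) \<le> 2 + n * ((2 * c\<^sup>2 * (\<sigma> * sqrt n) + c * sqrt c) * m)"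
      using expectation_abs_excess_le[OF less_imp_le[OF c] that] by (simp only: distrib_left)
    have "\<sigma> * sqrt k \<le> \<sigma> * sqrt n" using sigma_pos that by simp
    then have A1: "expectation (\<lambda>\<omega>. norm_Rn p (S k \<omega>)) \<le> \<sigma> * sqrt n"
      using expectation_partial_sum_norm_le[of k] by linarith
    have "k * (3 * \<sigma> ^ 3 * sqrt n + m) \<le> n * (3 * \<sigma> ^ 3 * sqrt n + m)"
      using that sigma_pos m_nonneg by (intro mult_right_mono) auto
    then have A3: "expectation (\<lambda>\<omega>. norm_Rn p (S k \<omega>) ^ 3) \<le> n * (3 * \<sigma> ^ 3 * sqrt n + m)"
      using expectation_partial_sum_cube_le[OF that] by linarith
    have "cmod (walk_char c s (Suc k) - (1 - of_real (z k)) * walk_char c s k) \<le> ?E"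
      using c m_nonneg
      by (intro order_trans[OF walk_char_Suc[OF c, of s k, unfolded zk]] add_mono mult_left_mono
            mult_right_mono excess A1 A3 order_refl) auto
    moreover have "cmod (of_real (1 - z k - exp (- z k)) * walk_char c s k) \<le> s ^ 4 / n\<^sup>2"
    proof -
      have "z k \<le> s\<^sup>2 / n"
      proof -
        have "z k \<le> s\<^sup>2 * n / n\<^sup>2"
          unfolding z_def using that by (intro divide_right_mono mult_left_mono) auto
        then show ?thesis using assms by (simp add: power2_eq_square)
      qed
      then have "(z k)\<^sup>2 \<le> (s\<^sup>2 / n)\<^sup>2" using z by (intro power_mono)
      moreover have "(s\<^sup>2 / n)\<^sup>2 = s ^ 4 / n\<^sup>2" by (simp add: power_divide)
      ultimately have "\<bar>1 - z k - exp (- z k)\<bar> \<le> s ^ 4 / n\<^sup>2"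
        using exp_minus_approx[OF z, of k] by linarith
      from mult_mono[OF this cmod_walk_char_le_1[of c s k]] show ?thesis
        by (simp only: norm_mult norm_of_real) simp
    qed
    ultimately have "cmod ((walk_char c s (Suc k) - (1 - of_real (z k)) * walk_char c s k)
        + of_real (1 - z k - exp (- z k)) * walk_char c s k) \<le> ?E + s ^ 4 / n\<^sup>2"
      by (rule norm_triangle_mono)
    then show ?thesis by (simp add: algebra_simps)
  qed
  have main: "k \<le> n \<Longrightarrow> cmod (walk_char c s k - of_real (exp (- (\<Sum>j<k. z j)))) \<le> k * (?E + s ^ 4 / n\<^sup>2)" for k
  proof (induction k)
    case 0
    show ?case by (simp add: walk_char_0)
  next
    case (Suc k)
    have "walk_char c s (Suc k) - of_real (exp (- (\<Sum>j<Suc k. z j)))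
       = (walk_char c s (Suc k) - of_real (exp (- z k)) * walk_char c s k)
         + of_real (exp (- z k)) * (walk_char c s k - of_real (exp (- (\<Sum>j<k. z j))))"
      by (simp add: algebra_simps exp_add flip: exp_of_real) (simp add: exp_add exp_diff exp_minus field_simps)
    moreover have "cmod (walk_char c s (Suc k) - of_real (exp (- z k)) * walk_char c s k) \<le> ?E + s ^ 4 / n\<^sup>2"
      using Suc.prems by (intro step) simp
    moreover have "cmod (of_real (exp (- z k)) * (walk_char c s k - of_real (exp (- (\<Sum>j<k. z j)))))
        \<le> 1 * (k * (?E + s ^ 4 / n\<^sup>2))"
      unfolding norm_mult using Suc z[of k] by (intro mult_mono) auto
    ultimately have "cmod (walk_char c s (Suc k) - of_real (exp (- (\<Sum>j<Suc k. z j))))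
        \<le> (?E + s ^ 4 / n\<^sup>2) + 1 * (k * (?E + s ^ 4 / n\<^sup>2))"
      by (metis norm_triangle_mono)
    also have "\<dots> = Suc k * (?E + s ^ 4 / n\<^sup>2)" by (simp add: distrib_right)
    finally show ?case .
  qed
  have gauss: "(\<Sum>j<k. real j) = k * (real k - 1) / 2" for k
    by (induction k) (auto simp: field_simps)
  have "(\<Sum>j<n. z j) = s\<^sup>2 * (n * (real n - 1) / 2) / n\<^sup>2"
    by (simp only: z_def gauss flip: sum_distrib_left sum_divide_distrib)
  also have "\<dots> = s\<^sup>2 * (real n - 1) / (2 * real n)"
    using assms by (simp add: power2_eq_square)
  finally have zs: "(\<Sum>j<n. z j) = s\<^sup>2 * (real n - 1) / (2 * real n)" .
  have "n * (?E + s ^ 4 / n\<^sup>2) = n * ?E + s ^ 4 / n"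
    using assms by (simp only: distrib_left) (simp add: power2_eq_square)
  with main[OF order_refl] show ?thesis
    unfolding zs walk_char_error_def Let_def c_def[symmetric] by simp
qed

end

section \<open>Moments of radial measures\<close>

lemma mat_apply_measurable: "mat_apply p A \<in> borel_Rn p \<rightarrow>\<^sub>M borel_Rn p"
proof -
  have "(\<lambda>x. \<lambda>i\<in>{..<p}. \<Sum>j<p. A i j * x j) \<in> borel_Rn p \<rightarrow>\<^sub>M borel_Rn p"
  proof (intro measurable_restrict borel_measurable_sum borel_measurable_times)
    fix i j assume "j \<in> {..<p}"
    then show "(\<lambda>x. x j) \<in> borel_measurable (borel_Rn p)"
      by (rule measurable_component_singleton)
  qed auto
  then show ?thesis unfolding mat_apply_def[abs_def] .
qed

lemma radial_measure_integral_mat_apply: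
  fixes f :: "(nat \<Rightarrow> real) \<Rightarrow> real"
  assumes "radial_measure p \<mu>" "orthogonal_mat_Rn p A" "f \<in> borel_measurable (borel_Rn p)"
  shows "(\<integral>x. f (mat_apply p A x) \<partial>\<mu>) = (\<integral>x. f x \<partial>\<mu>)"
proof -
  have s: "sets \<mu> = sets (borel_Rn p)" and d: "distr \<mu> (borel_Rn p) (mat_apply p A) = \<mu>"
    using assms(1,2) unfolding radial_measure_def by auto
  have "mat_apply p A \<in> \<mu> \<rightarrow>\<^sub>M borel_Rn p"
    using mat_apply_measurable by (simp cong: measurable_cong_sets add: s)
  from integral_distr[OF this assms(3)] show ?thesis unfolding d by simp
qed

text \<open>
  Sign changes of one coordinate and transpositions of two coordinates are the orthogonal maps from
  which the first two moments of a radial measure can be read off.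
\<close>

definition sign_flip_mat :: "nat \<Rightarrow> nat \<Rightarrow> nat \<Rightarrow> real" where
  "sign_flip_mat i a b = (if a = b then if a = i then - 1 else 1 else 0)"

definition swap_mat :: "nat \<Rightarrow> nat \<Rightarrow> nat \<Rightarrow> nat \<Rightarrow> real" where
  "swap_mat i j a b = (if b = Transposition.transpose i j a then 1 else 0)"

lemma orthogonal_sign_flip_mat: "orthogonal_mat_Rn p (sign_flip_mat i)"
  unfolding orthogonal_mat_Rn_def
proof (intro allI impI)
  fix a b assume "a < p" "b < p"
  have "(\<Sum>k<p. sign_flip_mat i k a * sign_flip_mat i k b) = (\<Sum>k<p. if k = a then (if a = b then 1 else 0) else 0)"
    by (intro sum.cong refl) (auto simp: sign_flip_mat_def)
  then show "(\<Sum>k<p. sign_flip_mat i k a * sign_flip_mat i k b) = (if a = b then 1 else 0)"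
    using \<open>a < p\<close> by simp
qed

lemma mat_apply_sign_flip:
  assumes "a < p"
  shows "mat_apply p (sign_flip_mat i) x a = (if a = i then - x a else x a)"
proof -
  have "(\<Sum>j<p. sign_flip_mat i a j * x j) = (\<Sum>j<p. if j = a then (if a = i then - x a else x a) else 0)"
    by (intro sum.cong refl) (auto simp: sign_flip_mat_def)
  then show ?thesis using assms by (simp add: mat_apply_def)
qed

lemma transpose_less: "i < p \<Longrightarrow> j < p \<Longrightarrow> a < p \<Longrightarrow> Transposition.transpose i j a < (p::nat)"
  by (auto simp: Transposition.transpose_def)

lemma orthogonal_swap_mat:
  assumes "i < p" "j < p"
  shows "orthogonal_mat_Rn p (swap_mat i j)"
  unfolding orthogonal_mat_Rn_def
proof (intro allI impI)
  fix a b assume "a < p" "b < p"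
  have "(\<Sum>k<p. swap_mat i j k a * swap_mat i j k b)
      = (\<Sum>k<p. if k = Transposition.transpose i j a then (if a = b then 1 else 0) else 0)"
    by (intro sum.cong refl) (auto simp: swap_mat_def)
  then show "(\<Sum>k<p. swap_mat i j k a * swap_mat i j k b) = (if a = b then 1 else 0)"
    using transpose_less[OF assms \<open>a < p\<close>] by simp
qed

lemma mat_apply_swap:
  assumes "i < p" "j < p" "a < p"
  shows "mat_apply p (swap_mat i j) x a = x (Transposition.transpose i j a)"
proof -
  have "(\<Sum>b<p. swap_mat i j a b * x b)
      = (\<Sum>b<p. if b = Transposition.transpose i j a then x (Transposition.transpose i j a) else 0)"
    by (intro sum.cong refl) (auto simp: swap_mat_def)
  then show ?thesis using assms transpose_less[OF assms] by (simp add: mat_apply_def)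
qed

lemma radial_measure_mean_zero:
  assumes "radial_measure p \<mu>" "i < p"
  shows "(\<integral>x. x i \<partial>\<mu>) = 0"
proof -
  have "(\<lambda>x. x i) \<in> borel_measurable (borel_Rn p)"
    using assms(2) by (intro measurable_component_singleton) simp
  from radial_measure_integral_mat_apply[OF assms(1) orthogonal_sign_flip_mat[of p i] this]
  show ?thesis using assms(2) by (simp add: mat_apply_sign_flip)
qed

lemma radial_measure_covariance:
  assumes "radial_measure p \<mu>" "integrable \<mu> (\<lambda>x. (norm_Rn p x)\<^sup>2)" "i < p" "j < p"
  shows "(\<integral>x. x i * x j \<partial>\<mu>) = (if i = j then (\<integral>x. (norm_Rn p x)\<^sup>2 \<partial>\<mu>) / p else 0)"
proof -
  have s: "sets \<mu> = sets (borel_Rn p)" using assms(1) unfolding radial_measure_def by auto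
  have meas: "(\<lambda>x. x a * x b) \<in> borel_measurable (borel_Rn p)" if "a < p" "b < p" for a b
    using that by (intro borel_measurable_times measurable_component_singleton) auto
  show ?thesis
  proof (cases "i = j")
    case False
    from radial_measure_integral_mat_apply[OF assms(1) orthogonal_sign_flip_mat[of p i] meas[OF assms(3,4)]]
    show ?thesis using assms(3,4) False by (simp add: mat_apply_sign_flip)
  next
    case True
    have eq: "(\<integral>x. x a * x a \<partial>\<mu>) = (\<integral>x. x i * x i \<partial>\<mu>)" if "a < p" for a
      using radial_measure_integral_mat_apply[OF assms(1) orthogonal_swap_mat[OF that assms(3)] meas[OF assms(3,3)]]
        that assms(3) by (simp add: mat_apply_swap)
    have int: "integrable \<mu> (\<lambda>x. x a * x a)" if "a < p" for a
    proof (rule Bochner_Integration.integrable_bound[OF assms(2)])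
      show "(\<lambda>x. x a * x a) \<in> borel_measurable \<mu>"
        using meas[OF that that] by (simp cong: measurable_cong_sets add: s)
      show "AE x in \<mu>. norm (x a * x a) \<le> norm ((norm_Rn p x)\<^sup>2)"
        unfolding power2_eq_square norm_mult
        using that by (intro AE_I2 mult_mono) (auto intro: abs_component_le_norm_Rn)
    qed
    have "(\<integral>x. (norm_Rn p x)\<^sup>2 \<partial>\<mu>) = (\<integral>x. (\<Sum>a<p. x a * x a) \<partial>\<mu>)"
      unfolding norm_Rn_power2 by (simp only: power2_eq_square)
    also have "\<dots> = (\<Sum>a<p. (\<integral>x. x a * x a \<partial>\<mu>))"
      by (rule Bochner_Integration.integral_sum) (simp add: int)
    also have "\<dots> = p * (\<integral>x. x i * x i \<partial>\<mu>)" by (simp add: eq)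
    finally show ?thesis using True assms(3) by simp
  qed
qed

section \<open>The central limit theorem for the squared norm\<close>

lemma isotropic_walk_radial:
  fixes \<nu> :: "real measure" and \<sigma> :: real
  assumes "prob_space \<Omega>" "d \<ge> 1" "\<sigma> > 0" "radial_prob_with_norm_law \<nu> d \<mu>"
    and indep: "prob_space.indep_vars \<Omega> (\<lambda>_. borel_Rn d) X {1..}"
    and law: "\<And>k. k \<ge> 1 \<Longrightarrow> distr \<Omega> (borel_Rn d) (X k) = \<mu>"
    and sigma: "\<sigma>\<^sup>2 = (\<integral>x. x\<^sup>2 \<partial>\<nu>)"
    and cube: "integrable \<nu> (\<lambda>x. (\<bar>x\<bar> + \<sigma>) ^ 3)" and sq: "integrable \<nu> (\<lambda>x. x\<^sup>2)"
  shows "isotropic_walk \<Omega> d \<sigma> (\<integral>x. (\<bar>x\<bar> + \<sigma>) ^ 3 \<partial>\<nu>) X"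
proof -
  interpret prob_space \<Omega> by fact
  have radial: "radial_measure d \<mu>" and norm: "distr \<mu> borel (norm_Rn d) = \<nu>"
    using assms(4) unfolding radial_prob_with_norm_law_def by auto
  have s: "sets \<mu> = sets (borel_Rn d)" using radial unfolding radial_measure_def by auto
  have nm: "norm_Rn d \<in> borel_measurable \<mu>"
    using norm_Rn_measurable[of d] by (simp cong: measurable_cong_sets add: s)
  have X: "X k \<in> \<Omega> \<rightarrow>\<^sub>M borel_Rn d" if "k \<ge> 1" for k
    using indep that unfolding indep_vars_def by auto
  have mu: "(\<integral>\<omega>. f (X k \<omega>) \<partial>\<Omega>) = (\<integral>x. f x \<partial>\<mu>)"
    if "k \<ge> 1" "f \<in> borel_measurable (borel_Rn d)" for k and f :: "(nat \<Rightarrow> real) \<Rightarrow> real"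
    using integral_distr[OF X[OF that(1)] that(2)] unfolding law[OF that(1)] by simp
  have nu: "(\<integral>x. f (norm_Rn d x) \<partial>\<mu>) = (\<integral>r. f r \<partial>\<nu>)"
      "integrable \<mu> (\<lambda>x. f (norm_Rn d x)) \<longleftrightarrow> integrable \<nu> f"
    if "f \<in> borel_measurable borel" for f :: "real \<Rightarrow> real"
    using integral_distr[OF nm that] integrable_distr_eq[OF nm that] unfolding norm by auto
  have sq_mu: "integrable \<mu> (\<lambda>x. (norm_Rn d x)\<^sup>2)" "(\<integral>x. (norm_Rn d x)\<^sup>2 \<partial>\<mu>) = \<sigma>\<^sup>2"
    using nu[of "\<lambda>r. r\<^sup>2"] sq sigma by auto
  show ?thesis
  proof unfold_locales
    fix k :: nat assume k: "k \<ge> 1"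
    have "integrable \<mu> (\<lambda>x. (norm_Rn d x + \<sigma>) ^ 3)"
      using nu(2)[of "\<lambda>r. (\<bar>r\<bar> + \<sigma>) ^ 3"] cube by simp
    then show "integrable \<Omega> (\<lambda>\<omega>. (norm_Rn d (X k \<omega>) + \<sigma>) ^ 3)"
      using integrable_distr_eq[OF X[OF k], of "\<lambda>x. (norm_Rn d x + \<sigma>) ^ 3"] unfolding law[OF k] by simp
    show "(\<integral>\<omega>. (norm_Rn d (X k \<omega>) + \<sigma>) ^ 3 \<partial>\<Omega>) = (\<integral>x. (\<bar>x\<bar> + \<sigma>) ^ 3 \<partial>\<nu>)"
      using mu[OF k, of "\<lambda>x. (norm_Rn d x + \<sigma>) ^ 3"] nu(1)[of "\<lambda>r. (\<bar>r\<bar> + \<sigma>) ^ 3"] by simp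
    fix i assume i: "i < d"
    then show "(\<integral>\<omega>. X k \<omega> i \<partial>\<Omega>) = 0"
      using mu[OF k, of "\<lambda>x. x i"] radial_measure_mean_zero[OF radial i]
      by (simp add: measurable_component_singleton)
    fix j assume j: "j < d"
    have "(\<lambda>x. x i * x j) \<in> borel_measurable (borel_Rn d)"
      using i j by (intro borel_measurable_times measurable_component_singleton) auto
    from mu[OF k this] radial_measure_covariance[OF radial sq_mu(1) i j]
    show "(\<integral>\<omega>. X k \<omega> i * X k \<omega> j \<partial>\<Omega>) = (if i = j then \<sigma>\<^sup>2 / d else 0)"
      unfolding sq_mu(2) by simp
  qed (use assms in auto)
qed

text \<open>
  In terms of \<open>x = sqrt p\<close> and \<open>y = sqrt n\<close> the contributions of the remainder terms are multiples of
  \<open>Q = x\<^sup>3 / y\<close>, \<open>Q / x\<close>, \<open>Q / y\<close> and \<open>sqrt (Q / y)\<close>, and \<open>Q\<^sup>2 = p\<^sup>3 / n\<close> tends to zero by assumption.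
\<close>

lemma walk_char_error_tendsto_0:
  fixes p :: "nat \<Rightarrow> nat" and \<sigma> m s :: real
  assumes "\<sigma> > 0" "filterlim p at_top sequentially"
    and "filterlim (\<lambda>n. real n / real (p n) ^ 3) at_top sequentially"
  shows "(\<lambda>n. walk_char_error \<sigma> m (p n) n s) \<longlonglongrightarrow> 0"
proof -
  define c where "c n = scaling \<sigma> (p n) n" for n
  define a where "a = \<sigma>\<^sup>2 * sqrt 2"
  define x y where "x n = sqrt (real (p n))" "y n = sqrt (real n)" for n
  have a: "a > 0" unfolding a_def using assms(1) by simp
  have xlim: "filterlim x at_top sequentially"
    unfolding x_y_def by (intro filterlim_compose[OF sqrt_at_top]
        filterlim_compose[OF filterlim_real_sequentially] assms(2))
  have ylim: "filterlim y at_top sequentially"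
    unfolding x_y_def by (intro filterlim_compose[OF sqrt_at_top] filterlim_real_sequentially)
  have "(\<lambda>n. sqrt (inverse (real n / real (p n) ^ 3))) \<longlonglongrightarrow> sqrt 0"
    by (intro tendsto_intros tendsto_inverse_0_at_top assms(3))
  moreover have "sqrt (inverse (real n / real (p n) ^ 3)) = x n ^ 3 / y n" for n
    unfolding x_y_def by (simp add: real_sqrt_divide real_sqrt_power)
  ultimately have Q: "(\<lambda>n. x n ^ 3 / y n) \<longlonglongrightarrow> 0" by simp
  have q4: "(\<lambda>n. x n ^ 3 / y n / a ^ 3 / y n) \<longlonglongrightarrow> 0"
    by (rule real_tendsto_divide_at_top[OF tendsto_divide[OF Q tendsto_const] ylim]) (use a in simp)
  have q3: "(\<lambda>n. x n ^ 3 / y n / a ^ 3) \<longlonglongrightarrow> 0"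
    using tendsto_divide[OF Q tendsto_const[of "a ^ 3"]] a by simp
  have q2: "(\<lambda>n. x n ^ 3 / y n / x n / a\<^sup>2) \<longlonglongrightarrow> 0"
    using tendsto_divide[OF real_tendsto_divide_at_top[OF Q xlim] tendsto_const[of "a\<^sup>2"]] a by simp
  have q1: "(\<lambda>n. sqrt (x n ^ 3 / y n / a ^ 3 / y n)) \<longlonglongrightarrow> 0"
    using tendsto_real_sqrt[OF q4] by simp
  have q0: "(\<lambda>n. \<sigma>\<^sup>2 / a / x n) \<longlonglongrightarrow> 0"
    by (rule real_tendsto_divide_at_top[OF tendsto_const xlim])
  have qn: "(\<lambda>n. s ^ 4 / real n) \<longlonglongrightarrow> 0"
    by (rule real_tendsto_divide_at_top[OF tendsto_const filterlim_real_sequentially])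
  have "(\<lambda>n. 2 * s\<^sup>2 * (\<sigma>\<^sup>2 / a / x n) * (2 + (2 * \<sigma> * (x n ^ 3 / y n / x n / a\<^sup>2) + sqrt (x n ^ 3 / y n / a ^ 3 / y n)) * m)
      + (4 / 3 * \<bar>s\<bar> ^ 3 * (3 * \<sigma> ^ 3 * (x n ^ 3 / y n / a ^ 3) + m * (x n ^ 3 / y n / a ^ 3 / y n))
          + 2 * s\<^sup>2 * \<sigma> * (x n ^ 3 / y n / x n / a\<^sup>2) + \<bar>s\<bar> * sqrt \<bar>s\<bar> * sqrt (x n ^ 3 / y n / a ^ 3 / y n)) * m
      + s ^ 4 / real n)
    \<longlonglongrightarrow> 2 * s\<^sup>2 * 0 * (2 + (2 * \<sigma> * 0 + 0) * m)
      + (4 / 3 * \<bar>s\<bar> ^ 3 * (3 * \<sigma> ^ 3 * 0 + m * 0) + 2 * s\<^sup>2 * \<sigma> * 0 + \<bar>s\<bar> * sqrt \<bar>s\<bar> * 0) * m + 0"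
    by (intro tendsto_add tendsto_mult tendsto_const q0 q1 q2 q3 q4 qn)
  moreover have "eventually (\<lambda>n. 2 * s\<^sup>2 * (\<sigma>\<^sup>2 / a / x n) * (2 + (2 * \<sigma> * (x n ^ 3 / y n / x n / a\<^sup>2) + sqrt (x n ^ 3 / y n / a ^ 3 / y n)) * m)
      + (4 / 3 * \<bar>s\<bar> ^ 3 * (3 * \<sigma> ^ 3 * (x n ^ 3 / y n / a ^ 3) + m * (x n ^ 3 / y n / a ^ 3 / y n))
          + 2 * s\<^sup>2 * \<sigma> * (x n ^ 3 / y n / x n / a\<^sup>2) + \<bar>s\<bar> * sqrt \<bar>s\<bar> * sqrt (x n ^ 3 / y n / a ^ 3 / y n)) * m
      + s ^ 4 / real n
     = walk_char_error \<sigma> m (p n) n s) sequentially"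
    using eventually_gt_at_top[of 0] filterlim_at_top_dense[THEN iffD1, OF xlim, rule_format, of 0]
  proof eventually_elim
    case (elim n)
    have y: "y n > 0" unfolding x_y_def using elim by simp
    have n: "real n = (y n)\<^sup>2" and p: "real (p n) = (x n)\<^sup>2" and yn: "sqrt (real n) = y n"
      unfolding x_y_def by auto
    have c: "c n = x n / (a * (y n)\<^sup>2)"
      unfolding c_def scaling_def a_def n[symmetric] by (simp add: x_y_def mult_ac)
    have cpos: "c n > 0" unfolding c using a y elim by simp
    \<comment> \<open>with all quantities expressed by \<open>x\<close> and \<open>y\<close>, the error becomes a combination of the null sequences above\<close>
    have e0: "n * c n * \<sigma>\<^sup>2 / p n = \<sigma>\<^sup>2 / a / x n"
      unfolding n p c using a y elim by (simp add: field_simps power2_eq_square)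
    have e2: "n * ((c n)\<^sup>2 * sqrt n) = x n ^ 3 / y n / x n / a\<^sup>2"
      unfolding yn unfolding n c using a y elim
      by (simp add: field_simps power2_eq_square power3_eq_cube)
    have e4: "n * (n * c n ^ 3) = x n ^ 3 / y n / a ^ 3 / y n"
      unfolding n c using a y elim by (simp add: field_simps power2_eq_square power3_eq_cube)
    have e3: "n * (n * c n ^ 3 * sqrt n) = x n ^ 3 / y n / a ^ 3"
      unfolding yn unfolding n c using a y elim
      by (simp add: field_simps power2_eq_square power3_eq_cube)
    have "n * (c n * sqrt (c n)) = sqrt ((n * c n)\<^sup>2 * c n)"
      using cpos by (simp add: real_sqrt_mult)
    also have "(n * c n)\<^sup>2 * c n = n * (n * c n ^ 3)"
      by (simp add: power2_eq_square power3_eq_cube)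
    finally have e1: "n * (c n * sqrt (c n)) = sqrt (x n ^ 3 / y n / a ^ 3 / y n)"
      unfolding e4 .
    have "n * (2 * s\<^sup>2 * c n * \<sigma>\<^sup>2 / p n * (2 + n * ((2 * (c n)\<^sup>2 * (\<sigma> * sqrt n) + c n * sqrt (c n)) * m))
      + (4 / 3 * \<bar>s\<bar> ^ 3 * c n ^ 3 * (n * (3 * \<sigma> ^ 3 * sqrt n + m))
          + 2 * s\<^sup>2 * (c n)\<^sup>2 * (\<sigma> * sqrt n) + \<bar>s\<bar> * sqrt \<bar>s\<bar> * (c n * sqrt (c n))) * m) + s ^ 4 / n
      = 2 * s\<^sup>2 * (n * c n * \<sigma>\<^sup>2 / p n)
          * (2 + (2 * \<sigma> * (n * ((c n)\<^sup>2 * sqrt n)) + n * (c n * sqrt (c n))) * m)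
        + (4 / 3 * \<bar>s\<bar> ^ 3 * (3 * \<sigma> ^ 3 * (n * (n * c n ^ 3 * sqrt n)) + m * (n * (n * c n ^ 3)))
          + 2 * s\<^sup>2 * \<sigma> * (n * ((c n)\<^sup>2 * sqrt n)) + \<bar>s\<bar> * sqrt \<bar>s\<bar> * (n * (c n * sqrt (c n)))) * m
        + s ^ 4 / n"
      by (simp add: algebra_simps add_divide_distrib)
    then show ?case
      unfolding walk_char_error_def Let_def c_def[symmetric] by (simp only: e0 e1 e2 e3 e4)
  qed
  ultimately show ?thesis
    by (simp only: mult_zero_right mult_zero_left add_0_right tendsto_cong)
qed

lemma char_radial_walk_tendsto:
  fixes \<Omega> :: "nat \<Rightarrow> 'a measure" and X :: "nat \<Rightarrow> nat \<Rightarrow> 'a \<Rightarrow> nat \<Rightarrow> real" and p :: "nat \<Rightarrow> nat"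
  assumes walk: "\<And>d. d \<ge> 1 \<Longrightarrow> isotropic_walk (\<Omega> d) d \<sigma> m (X d)"
    and p: "\<And>n. n \<ge> 1 \<Longrightarrow> p n \<ge> 1" and sigma: "\<sigma> > 0"
    and lims: "filterlim p at_top sequentially"
      "filterlim (\<lambda>n. real n / real (p n) ^ 3) at_top sequentially"
  shows "(\<lambda>n. CLINT \<omega>|\<Omega> (p n). iexp (s * (sqrt (real (p n)) / (real n * \<sigma>\<^sup>2 * sqrt 2) *
             ((norm_Rn (p n) (partial_sum_Rn (p n) (X (p n)) n \<omega>))\<^sup>2 - real n * \<sigma>\<^sup>2))))
         \<longlonglongrightarrow> of_real (exp (- s\<^sup>2 / 2))" (is "?walk_char \<longlonglongrightarrow> _")
proof -
  have "(\<lambda>n. s\<^sup>2 * (1 - 1 / real n) / 2) \<longlonglongrightarrow> s\<^sup>2 * (1 - 0) / 2"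
    by (intro tendsto_intros lim_1_over_n) auto
  then have "(\<lambda>n. s\<^sup>2 * (1 - 1 / real n) / 2) \<longlonglongrightarrow> s\<^sup>2 / 2" by simp
  moreover have "eventually (\<lambda>n. s\<^sup>2 * (1 - 1 / real n) / 2 = s\<^sup>2 * (real n - 1) / (2 * real n)) sequentially"
    using eventually_gt_at_top[of 0] by eventually_elim (simp add: field_simps)
  ultimately have "(\<lambda>n. s\<^sup>2 * (real n - 1) / (2 * real n)) \<longlonglongrightarrow> s\<^sup>2 / 2"
    by (rule Lim_transform_eventually)
  then have E: "(\<lambda>n. complex_of_real (exp (- (s\<^sup>2 * (real n - 1) / (2 * real n))))) \<longlonglongrightarrow> of_real (exp (- (s\<^sup>2 / 2)))"
    by (intro tendsto_of_real tendsto_exp tendsto_minus)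
  have "(\<lambda>n. ?walk_char n - of_real (exp (- (s\<^sup>2 * (real n - 1) / (2 * real n))))) \<longlonglongrightarrow> 0"
  proof (rule Lim_null_comparison[OF _ walk_char_error_tendsto_0[OF sigma lims, of m s]])
    show "eventually (\<lambda>n. norm (?walk_char n - of_real (exp (- (s\<^sup>2 * (real n - 1) / (2 * real n)))))
        \<le> walk_char_error \<sigma> m (p n) n s) sequentially"
      using eventually_ge_at_top[of 1]
    proof eventually_elim
      case (elim n)
      note W = walk[OF p[OF elim]]
      from isotropic_walk.walk_char_approx[OF W elim, of s]
      show ?case
        unfolding isotropic_walk.walk_char_def[OF W] isotropic_walk.excess_def[OF W] scaling_def .
    qed
  qed
  from tendsto_add[OF this E] show ?thesis by simp
qed

lemma second_moment_pos:
  assumes "real_distribution \<nu>" "\<nu> \<noteq> return borel 0" "integrable \<nu> (\<lambda>x. x\<^sup>2)"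
  shows "(\<integral>x. x\<^sup>2 \<partial>\<nu>) > 0"
proof (rule ccontr)
  interpret real_distribution \<nu> by fact
  assume "\<not> (\<integral>x. x\<^sup>2 \<partial>\<nu>) > 0"
  moreover have "(\<integral>x. x\<^sup>2 \<partial>\<nu>) \<ge> 0" by (rule Bochner_Integration.integral_nonneg) simp
  ultimately have "(\<integral>x. x\<^sup>2 \<partial>\<nu>) = 0" by simp
  then have ae: "AE x in \<nu>. x = 0"
    using integral_nonneg_eq_0_iff_AE[OF assms(3)] by simp
  have "\<nu> = return borel 0"
  proof (rule measure_eqI)
    fix A assume A: "A \<in> sets \<nu>"
    have "emeasure \<nu> A = emeasure \<nu> {x \<in> space \<nu>. 0 \<in> A}"
      using ae A by (intro emeasure_eq_AE) auto
    also have "\<dots> = emeasure (return borel 0) A"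
      using A emeasure_space_1 by (cases "0 \<in> A") auto
    finally show "emeasure \<nu> A = emeasure (return borel 0) A" .
  qed simp
  with assms(2) show False by contradiction
qed

text \<open>
  The laws for \<open>n = 0\<close> need not be probability measures, because the dimension \<open>p 0\<close> is arbitrary.
  Levy's theorem is therefore applied to the sequence from index \<open>1\<close> on.
\<close>

lemma weak_conv_m_Suc:
  assumes "weak_conv_m (\<lambda>n. M (Suc n)) M'"
  shows "weak_conv_m M M'"
  using assms unfolding weak_conv_m_def weak_conv_def by (auto intro: LIMSEQ_imp_Suc)

theorem theorem1p1:
  fixes \<nu> :: "real measure"
    and \<nu>p :: "nat \<Rightarrow> (nat \<Rightarrow> real) measure"
    and \<sigma> :: real
    and \<Omega> :: "nat \<Rightarrow> 'a measure"
    and X :: "nat \<Rightarrow> nat \<Rightarrow> 'a \<Rightarrow> nat \<Rightarrow> real"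
    and p :: "nat \<Rightarrow> nat"
  assumes "real_distribution \<nu>"
    and "AE x in \<nu>. 0 \<le> x"
    and "\<nu> \<noteq> return borel 0"
    and "integrable \<nu> (\<lambda>x. x ^ 3)"
    and "\<sigma>\<^sup>2 = (\<integral>x. x\<^sup>2 \<partial>\<nu>)"
    and "\<And>d. d \<ge> 1 \<Longrightarrow> radial_prob_with_norm_law \<nu> d (\<nu>p d)"
    and "\<And>d. d \<ge> 1 \<Longrightarrow> prob_space (\<Omega> d)"
    and "\<And>d. d \<ge> 1 \<Longrightarrow> prob_space.indep_vars (\<Omega> d) (\<lambda>_. borel_Rn d) (X d) {1..}"
    and "\<And>d k. d \<ge> 1 \<Longrightarrow> k \<ge> 1 \<Longrightarrow> distr (\<Omega> d) (borel_Rn d) (X d k) = \<nu>p d"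
    and "\<And>n. n \<ge> 1 \<Longrightarrow> p n \<ge> 1"
    and "filterlim p at_top sequentially"
    and "filterlim (\<lambda>n. real n / real (p n) ^ 3) at_top sequentially"
  shows "weak_conv_m
    (\<lambda>n. distr (\<Omega> (p n)) borel
       (\<lambda>\<omega>. sqrt (real (p n)) / (real n * \<sigma>\<^sup>2 * sqrt 2) *
             ((norm_Rn (p n) (partial_sum_Rn (p n) (X (p n)) n \<omega>))\<^sup>2 - real n * \<sigma>\<^sup>2)))
    std_normal_distribution"
proof (rule weak_conv_m_Suc)
  interpret nu: real_distribution \<nu> by fact
  \<comment> \<open>the sign of \<open>\<sigma>\<close> is not prescribed, only its square\<close>
  define \<tau> where "\<tau> = \<bar>\<sigma>\<bar>"
  have tau2: "\<tau>\<^sup>2 = \<sigma>\<^sup>2" unfolding \<tau>_def by simp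
  have sq: "integrable \<nu> (\<lambda>x. x\<^sup>2)"
  proof (rule Bochner_Integration.integrable_bound)
    show "integrable \<nu> (\<lambda>x. 1 + \<bar>x ^ 3\<bar>)" using assms(4) by simp
    have "x\<^sup>2 \<le> 1 + \<bar>x ^ 3\<bar>" for x :: real
    proof (cases "\<bar>x\<bar> \<le> 1")
      case True
      then show ?thesis using abs_square_le_1[of x] by linarith
    next
      case False
      then show ?thesis using power_increasing[of 2 3 "\<bar>x\<bar>"] by (simp add: power_abs)
    qed
    then show "AE x in \<nu>. norm (x\<^sup>2) \<le> norm (1 + \<bar>x ^ 3\<bar>)" by (intro AE_I2) simp
  qed simp
  have "\<sigma>\<^sup>2 > 0" using second_moment_pos[OF assms(1,3) sq] assms(5) by simp
  then have tau: "\<tau> > 0" unfolding \<tau>_def by auto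
  have cube: "integrable \<nu> (\<lambda>x. (\<bar>x\<bar> + \<tau>) ^ 3)"
  proof (rule Bochner_Integration.integrable_bound)
    show "integrable \<nu> (\<lambda>x. 8 * (\<bar>x ^ 3\<bar> + \<tau> ^ 3))" using assms(4) by simp
    have "(\<bar>x\<bar> + \<tau>) ^ 3 \<le> 8 * (\<bar>x ^ 3\<bar> + \<tau> ^ 3)" for x :: real
    proof -
      have "(\<bar>x\<bar> + \<tau>) ^ 3 \<le> (2 * max \<bar>x\<bar> \<tau>) ^ 3" using tau by (intro power_mono) auto
      also have "\<dots> \<le> 8 * (\<bar>x ^ 3\<bar> + \<tau> ^ 3)"
        using tau by (auto simp: power_mult_distrib max_def power_abs)
      finally show ?thesis .
    qed
    then show "AE x in \<nu>. norm ((\<bar>x\<bar> + \<tau>) ^ 3) \<le> norm (8 * (\<bar>x ^ 3\<bar> + \<tau> ^ 3))"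
      using tau by (intro AE_I2) simp
  qed simp
  have walk: "isotropic_walk (\<Omega> d) d \<tau> (\<integral>x. (\<bar>x\<bar> + \<tau>) ^ 3 \<partial>\<nu>) (X d)" if "d \<ge> 1" for d
    using assms(5-9) that tau cube sq tau2
    by (intro isotropic_walk_radial[where \<mu> = "\<nu>p d"]) auto
  let ?Z = "\<lambda>n \<omega>. sqrt (real (p n)) / (real n * \<sigma>\<^sup>2 * sqrt 2) *
             ((norm_Rn (p n) (partial_sum_Rn (p n) (X (p n)) n \<omega>))\<^sup>2 - real n * \<sigma>\<^sup>2)"
  have Z: "?Z n \<in> borel_measurable (\<Omega> (p n))" if "n \<ge> 1" for n
  proof -
    have "partial_sum_Rn (p n) (X (p n)) n \<in> \<Omega> (p n) \<rightarrow>\<^sub>M borel_Rn (p n)"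
      by (rule isotropic_walk.partial_sum_measurable[OF walk[OF assms(10)[OF that]]])
    from measurable_compose[OF this norm_Rn_measurable] show ?thesis by simp
  qed
  have char: "char (distr (\<Omega> (p n)) borel (?Z n)) s = (CLINT \<omega>|\<Omega> (p n). iexp (s * ?Z n \<omega>))"
    if "n \<ge> 1" for n s
    unfolding char_def using Z[OF that] by (subst integral_distr) auto
  show "weak_conv_m (\<lambda>n. distr (\<Omega> (p (Suc n))) borel (?Z (Suc n))) std_normal_distribution"
  proof (rule levy_continuity[OF _ real_dist_normal_dist])
    show "real_distribution (distr (\<Omega> (p (Suc n))) borel (?Z (Suc n)))" for n
      using assms(7)[OF assms(10)] Z[of "Suc n"] by (intro prob_space.real_distribution_distr) auto
    fix s
    have "(\<lambda>n. CLINT \<omega>|\<Omega> (p n). iexp (s * ?Z n \<omega>)) \<longlonglongrightarrow> of_real (exp (- s\<^sup>2 / 2))"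
      using char_radial_walk_tendsto[OF walk assms(10) tau assms(11,12)] unfolding tau2 .
    have le: "1 \<le> Suc n" for n by simp
    from LIMSEQ_Suc[OF \<open>_ \<longlonglongrightarrow> of_real (exp (- s\<^sup>2 / 2))\<close>]
    show "(\<lambda>n. char (distr (\<Omega> (p (Suc n))) borel (?Z (Suc n))) s) \<longlonglongrightarrow> char std_normal_distribution s"
      by (simp only: char[OF le] char_std_normal_distribution)
  qed
qed

end
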